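(* Let $d=d_3d_4^2$ with $d_3,d_4$ squarefree, coprime, $d_4<d_3$, and $d\equiv\pm2,\pm4\pmod 9$; let $L=\mathbb{Q}(\sqrt[3]{d})$. Assume there exists a principal factor $\alpha\in\mathcal{O}_L$ with $N_{L/\mathbb{Q}}(\alpha)=9d_4$, and put $\bar\alpha=\alpha^2/3$ (which has norm $3d_4^2$). Let $Z_+\approx1.40080587$ be the unique positive zero of $Q_4(X)=X^4+X^3+X-8$, and $C_1=(-1+\sqrt{33})/2$. Then: (i) $L$ is an $\mathrm{M}0$-field, i.e. neither $\alpha$ nor $\bar\alpha$ lies in $\mathrm{Min}(\mathcal{O}_L)$, if and only if $d_3\equiv -d_4\pmod 3$ and $d_3<Z_+^3\,d_4$. (ii) $L$ is an $\mathrm{M}1$-field in the sense that $\alpha\notin\mathrm{Min}(\mathcal{O}_L)$ but $\bar\alpha\in\mathrm{Min}(\mathcal{O}_L)$, if and only if either $d_3\equiv-d_4\pmod 3$ and $Z_+^3d_4\le d_3<8d_4$, or $d_3\equiv d_4\pmod 3$ and $d_3<C_1^3d_4$. (iii) $L$ is an $\mathrm{M}2$-field in the sense that both $\alpha\in\mathrm{Min}(\mathcal{O}_L)$ and $\bar\alpha\in\mathrm{Min}(\mathcal{O}_L)$, if and only if either $d_3\equiv -d_4\pmod 3$ and $8d_4\le d_3$, or $d_3\equiv d_4\pmod 3$ and $C_1^3d_4\le d_3$.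
   Context: Notation: $L\subset\mathbb{R}$, $\delta=\sqrt[3]{d}$ real, $\zeta_3$ a primitive cube root of unity, $\mathit{k}_0=\mathbb{Q}(\zeta_3)$, $\mathit{k}=L(\zeta_3)$, $\sigma$ the generator of $\mathrm{Gal}(\mathit{k}/\mathit{k}_0)$ with $\sigma(\delta)=\zeta_3\delta$; $\mathcal{O}_L$ the maximal order. For $\alpha\in L$, $\alpha'=\sigma(\alpha)$, $\alpha''=\sigma^2(\alpha)$ (complex conjugates). An $\alpha\in\mathcal{O}_L$ with $\alpha>0$ is a lattice minimum of $\mathcal{O}_L$ if every $\beta\in\mathcal{O}_L$ with $\beta'\beta''<\alpha'\alpha''$ and $0\le\beta<\alpha$ is $0$; $\mathrm{Min}(\mathcal{O}_L)$ denotes the set of these. A principal factor is $\alpha\in\mathcal{O}_L$ with $\sigma(\alpha\mathcal{O}_{\mathit{k}})=\alpha\mathcal{O}_{\mathit{k}}$ such that $\alpha\mathcal{O}_L\not\subseteq m\mathcal{O}_L$ for every integer $m>1$. *)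

theory Defs
  imports
    "HOL-Analysis.Analysis"
    "HOL-Algebra.Algebraic_Closure_Type"
    "HOL-Algebra.Generated_Fields"
    "HOL-Computational_Algebra.Squarefree"
    "HOL-Number_Theory.Cong"
begin

text \<open>Number fields are subfields of \<^typ>\<open>real\<close> or \<^typ>\<open>complex\<close>, given as sets. In
  characteristic 0 the subfield generated by \<open>S\<close> is \<open>\<rat>(S)\<close>.\<close>

definition rat_adjoin :: "'a::field_char_0 set \<Rightarrow> 'a set" where
  "rat_adjoin S = generate_field ring_of_type_algebra S"

definition maximal_order :: "'a::field_char_0 set \<Rightarrow> 'a set" where
  "maximal_order K = {x \<in> K. algebraic_int x}"

definition Galois_group :: "'a::field_char_0 set \<Rightarrow> 'a set \<Rightarrow> ('a \<Rightarrow> 'a) set" where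
  "Galois_group K F =
     {\<sigma> \<in> ring_iso (ring_of_type_algebra\<lparr>carrier := K\<rparr>) (ring_of_type_algebra\<lparr>carrier := K\<rparr>).
        \<forall>x\<in>F. \<sigma> x = x}"

lemma Galois_group_iff:
  "\<sigma> \<in> Galois_group K F \<longleftrightarrow>
     bij_betw \<sigma> K K \<and> \<sigma> 1 = 1 \<and> (\<forall>x\<in>K. \<forall>y\<in>K. \<sigma> (x + y) = \<sigma> x + \<sigma> y) \<and>
     (\<forall>x\<in>K. \<forall>y\<in>K. \<sigma> (x * y) = \<sigma> x * \<sigma> y) \<and> (\<forall>x\<in>F. \<sigma> x = x)"
  by (auto simp: Galois_group_def ring_iso_def ring_hom_def ring_of_type_algebra_def bij_betw_def)

definition pure_cubic_field :: "nat \<Rightarrow> real set" where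
  "pure_cubic_field d = rat_adjoin {root 3 (real d)}"

definition pure_cubic_closure :: "nat \<Rightarrow> complex \<Rightarrow> complex set" where
  "pure_cubic_closure d \<zeta> = rat_adjoin (complex_of_real ` pure_cubic_field d \<union> {\<zeta>})"

definition is_cubic_conjugation :: "nat \<Rightarrow> complex \<Rightarrow> (complex \<Rightarrow> complex) \<Rightarrow> bool" where
  "is_cubic_conjugation d \<zeta> \<sigma> \<longleftrightarrow>
     \<sigma> \<in> Galois_group (pure_cubic_closure d \<zeta>) (rat_adjoin {\<zeta>}) \<and>
     \<sigma> (complex_of_real (root 3 (real d))) = \<zeta> * complex_of_real (root 3 (real d))"

definition conj1 :: "(complex \<Rightarrow> complex) \<Rightarrow> real \<Rightarrow> complex" where
  "conj1 \<sigma> \<alpha> = \<sigma> (complex_of_real \<alpha>)"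

definition conj2 :: "(complex \<Rightarrow> complex) \<Rightarrow> real \<Rightarrow> complex" where
  "conj2 \<sigma> \<alpha> = \<sigma> (\<sigma> (complex_of_real \<alpha>))"

definition cubic_norm :: "(complex \<Rightarrow> complex) \<Rightarrow> real \<Rightarrow> complex" where
  "cubic_norm \<sigma> \<alpha> = complex_of_real \<alpha> * conj1 \<sigma> \<alpha> * conj2 \<sigma> \<alpha>"

text \<open>The two conjugates of an element of the cubic field are complex conjugates of each other, so
  their product is real; \<^const>\<open>Re\<close> only makes the order of the reals available.\<close>

definition lattice_minima :: "(complex \<Rightarrow> complex) \<Rightarrow> real set \<Rightarrow> real set" where
  "lattice_minima \<sigma> M =
     {\<alpha> \<in> M. \<alpha> > 0 \<and>
        (\<forall>\<beta>\<in>M. Re (conj1 \<sigma> \<beta> * conj2 \<sigma> \<beta>) < Re (conj1 \<sigma> \<alpha> * conj2 \<sigma> \<alpha>) \<and> 0 \<le> \<beta> \<and> \<beta> < \<alpha>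
            \<longrightarrow> \<beta> = 0)}"

definition principal_ideal :: "'a::field_char_0 \<Rightarrow> 'a set \<Rightarrow> 'a set" where
  "principal_ideal \<alpha> R = (\<lambda>x. \<alpha> * x) ` R"

definition principal_factor :: "nat \<Rightarrow> complex \<Rightarrow> (complex \<Rightarrow> complex) \<Rightarrow> real \<Rightarrow> bool" where
  "principal_factor d \<zeta> \<sigma> \<alpha> \<longleftrightarrow>
     (let OL = maximal_order (pure_cubic_field d);
          Ok = maximal_order (pure_cubic_closure d \<zeta>)
      in \<alpha> \<in> OL \<and>
         \<sigma> ` principal_ideal (complex_of_real \<alpha>) Ok = principal_ideal (complex_of_real \<alpha>) Ok \<and>
         (\<forall>m::int. m > 1 \<longrightarrow> \<not> principal_ideal \<alpha> OL \<subseteq> principal_ideal (of_int m) OL))"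

definition Q4 :: "real \<Rightarrow> real" where
  "Q4 x = x ^ 4 + x ^ 3 + x - 8"

definition Z_plus :: real where
  "Z_plus = (THE x. x > 0 \<and> Q4 x = 0)"

definition C1 :: real where
  "C1 = (- 1 + sqrt 33) / 2"

lemma Q4_strict_mono:
  assumes "0 \<le> x" "x < y"
  shows "Q4 x < Q4 y"
proof -
  have "x ^ 4 < y ^ 4" "x ^ 3 < y ^ 3"
    using assms by (auto intro: power_strict_mono)
  with assms show ?thesis by (simp add: Q4_def)
qed

lemma Z_plus_ex1: "\<exists>!x. x > 0 \<and> Q4 x = 0"
  and Z_plus_approx: "\<bar>Z_plus - 1.40080587\<bar> < 5 / 10 ^ 9"
proof -
  have lo: "Q4 (1.400805865) < 0" and hi: "Q4 (1.400805875) > 0"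
    by (simp_all add: Q4_def power4_eq_xxxx power3_eq_cube)
  have "\<exists>x\<ge>1.400805865. x \<le> 1.400805875 \<and> Q4 x = 0"
    by (rule IVT') (use lo hi in \<open>auto simp: Q4_def intro!: continuous_intros\<close>)
  then obtain z where z: "1.400805865 \<le> z" "z \<le> 1.400805875" "Q4 z = 0" by blast
  have uniq: "x = z" if "x > 0 \<and> Q4 x = 0" for x
    using Q4_strict_mono[of x z] Q4_strict_mono[of z x] that z by (cases x z rule: linorder_cases) auto
  show "\<exists>!x. x > 0 \<and> Q4 x = 0"
    using z uniq by (intro ex1I[of _ z]) auto
  have "Z_plus = z"
    unfolding Z_plus_def using z uniq by (intro the_equality) auto
  moreover have "z \<noteq> 1.400805865" "z \<noteq> 1.400805875"
    using z(3) lo hi by (metis less_irrefl)+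
  ultimately show "\<bar>Z_plus - 1.40080587\<bar> < 5 / 10 ^ 9"
    using z by (auto simp: abs_if)
qed

end

theory Submission
  imports Defs "Jordan_Normal_Form.Char_Poly"
begin

text \<open>
  Write \<open>p = d\<^sub>3\<close>, \<open>q = d\<^sub>4\<close> and \<open>t\<close> for the cube root of \<open>p / q\<close>; then \<open>1\<close>, \<open>q t\<close>, \<open>q t\<^sup>2\<close> is an
  integral basis. Invariance of the ideal of \<open>\<alpha>\<close> under \<open>\<sigma>\<close> makes \<open>\<epsilon> = \<alpha>\<^sup>3 / (9 q)\<close> a unit, and
  \<open>\<alpha>\<close> is a minimum of the maximal order iff \<open>1\<close> is a minimum of the lattice of all \<open>\<xi>\<close> with
  \<open>\<alpha> \<xi>\<close> integral; likewise for \<open>\<alpha>\<^sup>2 / 3\<close>. Both lattices are explicit: for \<open>\<xi>\<close> in the first,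
  \<open>3 q \<xi> = (\<alpha> \<xi> / \<epsilon>) (\<alpha>\<^sup>2 / 3)\<close> is integral of norm divisible by \<open>3 q\<^sup>2\<close>, which forces
  congruences on its coordinates (symmetrically for the second), while a given \<open>\<xi>\<close> is recognised
  as a member from the cube of \<open>\<alpha> \<xi>\<close>. The three terms of a lattice point in the critical cylinder
  all lie in \<open>(-2/3, 1)\<close>, so only finitely many candidates remain. The decisive ones are
  \<open>(t \<plusminus> 1) / 3\<close> and \<open>(1 - t + t\<^sup>2) / 3\<close>, whose conjugates have squared absolute value
  \<open>(1 + t\<^sup>2 \<minusplus> t) / 9\<close> and \<open>(t\<^sup>4 + t\<^sup>3 + t + 1) / 9\<close>; this is where the bounds \<open>2\<close>, \<open>C\<^sub>1\<close> and
  \<open>Z\<^sub>+\<close> on \<open>t\<close> come from.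
\<close>

section \<open>Sums and products of algebraic integers\<close>

text \<open>The determinant trick: multiplication by \<open>z\<close> acts on the elements of
  \<open>S\<close> through an integer matrix, with the vector of these elements as an eigenvector,
  so \<open>z\<close> is a root of a monic integer characteristic polynomial.\<close>

lemma algebraic_int_if_stable:
  fixes z :: "'a::field_char_0" and S :: "'a set"
  assumes fin: "finite S" and nz: "\<exists>s\<in>S. s \<noteq> 0"
    and stable: "\<And>s. s \<in> S \<Longrightarrow> \<exists>c::'a \<Rightarrow> int. z * s = (\<Sum>r\<in>S. of_int (c r) * r)"
  shows "algebraic_int z"
proof -
  obtain c :: "'a \<Rightarrow> 'a \<Rightarrow> int" where c: "\<And>s. s \<in> S \<Longrightarrow> z * s = (\<Sum>r\<in>S. of_int (c s r) * r)"
    using stable by metis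
  define n where "n = card S"
  obtain h where h: "bij_betw h {0..<n} S"
    using ex_bij_betw_nat_finite[OF fin] unfolding n_def by blast
  define A where "A = mat n n (\<lambda>(i, j). c (h i) (h j))"
  define B where "B = (map_mat of_int A :: 'a mat)"
  define v where "v = vec n h"
  have A: "A \<in> carrier_mat n n" and B: "B \<in> carrier_mat n n"
    by (auto simp: A_def B_def)
  obtain i where i: "i < n" "h i \<noteq> 0"
    using nz h by (metis atLeastLessThan_iff bij_betw_iff_bijections)
  have "v \<noteq> 0\<^sub>v n"
    using i by (metis index_vec index_zero_vec(1) v_def)
  moreover have "B *\<^sub>v v = z \<cdot>\<^sub>v v"
  proof (rule eq_vecI)
    fix i assume "i < dim_vec (z \<cdot>\<^sub>v v)"
    then have i: "i < n" by (simp add: v_def)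
    then have hi: "h i \<in> S" using h by (auto simp: bij_betw_def)
    have "vec_index (B *\<^sub>v v) i = (\<Sum>j = 0..<n. of_int (c (h i) (h j)) * h j)"
      using i by (auto simp: B_def A_def v_def scalar_prod_def)
    also have "\<dots> = (\<Sum>r\<in>S. of_int (c (h i) r) * r)"
      using h by (rule sum.reindex_bij_betw)
    also have "\<dots> = z * h i" using c[OF hi] by simp
    finally show "vec_index (B *\<^sub>v v) i = vec_index (z \<cdot>\<^sub>v v) i" using i by (simp add: v_def)
  qed (auto simp: B_def A_def v_def)
  ultimately have "eigenvalue B z"
    using B unfolding eigenvalue_def eigenvector_def by (intro exI[of _ v]) (auto simp: v_def)
  then have "poly (char_poly B) z = 0"
    using eigenvalue_root_char_poly[OF B] by blast
  then have "poly (map_poly of_int (char_poly A)) z = 0"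
    unfolding B_def by (simp add: of_int_hom.char_poly_hom[OF A])
  moreover have "Polynomial.lead_coeff (char_poly A) = 1"
    using degree_monic_char_poly[OF A] by simp
  ultimately show ?thesis
    unfolding algebraic_int_altdef_ipoly by blast
qed

text \<open>The monomials \<open>x ^ i * y ^ j\<close> below the two degrees span a group that is stable under
  multiplication by \<open>x\<close> and by \<open>y\<close>.\<close>

lemma algebraic_int_add_mult:
  fixes x y :: "'a::field_char_0"
  assumes "algebraic_int x" "algebraic_int y"
  shows "algebraic_int (x + y) \<and> algebraic_int (x * y)"
proof -
  interpret Z: Modules.module "\<lambda>(k::int) (z::'a). of_int k * z"
    by unfold_locales (auto simp: algebra_simps)
  obtain p where p: "poly (map_poly of_int p) x = 0" "Polynomial.lead_coeff p = 1"
    using assms(1) unfolding algebraic_int_altdef_ipoly by blast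
  obtain q where q: "poly (map_poly of_int q) y = 0" "Polynomial.lead_coeff q = 1"
    using assms(2) unfolding algebraic_int_altdef_ipoly by blast
  define m n where "m = Polynomial.degree p" and "n = Polynomial.degree q"
  \<comment> \<open>A monic relation rewrites the top power by lower ones; reaching such a power is
    the only way in which multiplication by \<open>x\<close> or \<open>y\<close> leads out of
    \<open>S\<close>.\<close>
  have top: "w ^ Polynomial.degree r = (\<Sum>k<Polynomial.degree r. of_int (- Polynomial.coeff r k) * w ^ k)"
    if "poly (map_poly of_int r) w = 0" "Polynomial.lead_coeff r = 1" for w :: 'a and r
  proof -
    have "0 = (\<Sum>k\<le>Polynomial.degree r. of_int (Polynomial.coeff r k) * w ^ k)"
      using that by (simp add: poly_altdef degree_map_poly coeff_map_poly)
    also have "\<dots> = (\<Sum>k<Polynomial.degree r. of_int (Polynomial.coeff r k) * w ^ k) + w ^ Polynomial.degree r"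
      using that by (simp add: lessThan_Suc_atMost[symmetric])
    finally show ?thesis by (simp add: sum_negf eq_neg_iff_add_eq_0 add.commute)
  qed
  have pos: "Polynomial.degree r > 0" if "poly (map_poly of_int r) w = 0" "Polynomial.lead_coeff r = 1" for w :: 'a and r
  proof (rule ccontr)
    assume "\<not> Polynomial.degree r > 0"
    then show False using top[OF that] by simp
  qed
  have mn: "m > 0" "n > 0" using pos p q by (auto simp: m_def n_def)
  define S where "S = (\<lambda>(i, j). x ^ i * y ^ j) ` ({..<m} \<times> {..<n})"
  have fin: "finite S" by (simp add: S_def)
  have "(1::'a) \<in> S" using mn unfolding S_def by (intro image_eqI[of _ _ "(0, 0)"]) auto
  then have nz: "\<exists>s\<in>S. s \<noteq> 0" by (rule bexI[rotated]) simp
  have base: "x ^ i * y ^ j \<in> S" if "i < m" "j < n" for i j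
    using that by (auto simp: S_def)
  have topx: "x ^ m * y ^ j \<in> Z.span S" if "j < n" for j
  proof -
    have "x ^ m * y ^ j = (\<Sum>k<m. of_int (- Polynomial.coeff p k) * (x ^ k * y ^ j))"
      using top[OF p] by (simp add: m_def sum_distrib_right mult.assoc)
    also have "\<dots> \<in> Z.span S"
      using that by (intro Z.span_sum Z.span_scale Z.span_base base) auto
    finally show ?thesis .
  qed
  have topy: "x ^ i * y ^ n \<in> Z.span S" if "i < m" for i
  proof -
    have "x ^ i * y ^ n = (\<Sum>k<n. of_int (- Polynomial.coeff q k) * (x ^ i * y ^ k))"
      using top[OF q] by (simp add: n_def sum_distrib_left mult_ac)
    also have "\<dots> \<in> Z.span S"
      using that by (intro Z.span_sum Z.span_scale Z.span_base base) auto
    finally show ?thesis .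
  qed
  have gen: "w * s \<in> Z.span S" if "\<And>r. r \<in> S \<Longrightarrow> w * r \<in> Z.span S" "s \<in> Z.span S" for w s
    using that(2)
  proof (rule Z.span_induct)
    show "Z.subspace {s. w * s \<in> Z.span S}"
    proof (rule Z.subspaceI)
      fix c :: int and s assume "s \<in> {s. w * s \<in> Z.span S}"
      then have "of_int c * (w * s) \<in> Z.span S" by (simp add: Z.span_scale)
      then show "of_int c * s \<in> {s. w * s \<in> Z.span S}" by (simp only: mult.left_commute mem_Collect_eq)
    qed (auto simp: distrib_left Z.span_zero intro: Z.span_add)
  qed (use that in auto)
  have sx: "x * s \<in> Z.span S" if s: "s \<in> S" for s
  proof -
    obtain i j where ij: "i < m" "j < n" "s = x ^ i * y ^ j" using s by (auto simp: S_def)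
    have "x ^ Suc i * y ^ j \<in> Z.span S"
    proof (cases "Suc i = m")
      case True
      show ?thesis unfolding True using ij(2) by (rule topx)
    next
      case False
      then show ?thesis using ij by (intro Z.span_base base) auto
    qed
    then show ?thesis by (simp only: ij(3) power_Suc mult.assoc)
  qed
  have sy: "y * s \<in> Z.span S" if s: "s \<in> S" for s
  proof -
    obtain i j where ij: "i < m" "j < n" "s = x ^ i * y ^ j" using s by (auto simp: S_def)
    have "x ^ i * y ^ Suc j \<in> Z.span S"
    proof (cases "Suc j = n")
      case True
      show ?thesis unfolding True using ij(1) by (rule topy)
    next
      case False
      then show ?thesis using ij by (intro Z.span_base base) auto
    qed
    then show ?thesis by (simp only: ij(3) power_Suc mult.left_commute)
  qed
  have sum: "(x + y) * s \<in> Z.span S" and prod: "x * y * s \<in> Z.span S" if "s \<in> S" for s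
    using Z.span_add[OF sx sy] gen[OF sx sy] that by (auto simp: distrib_right mult.assoc)
  have "algebraic_int z" if "\<And>s. s \<in> S \<Longrightarrow> z * s \<in> Z.span S" for z
    using that unfolding Z.span_finite[OF fin] by (intro algebraic_int_if_stable[OF fin nz]) blast
  with sum prod show ?thesis by blast
qed

lemma algebraic_int_add: "algebraic_int x \<Longrightarrow> algebraic_int y \<Longrightarrow> algebraic_int (x + y)"
  and algebraic_int_mult: "algebraic_int x \<Longrightarrow> algebraic_int y \<Longrightarrow> algebraic_int (x * y)"
  for x y :: "'a::field_char_0"
  using algebraic_int_add_mult by blast+

lemma algebraic_int_if_power:
  fixes x :: "'a::field_char_0"
  assumes "algebraic_int (x ^ n)" "n > 0"
  shows "algebraic_int x"
  by (rule algebraic_int_root[where p = "Polynomial.monom 1 n" and y = "x ^ n"])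
     (use assms in \<open>auto simp: poly_monom degree_monom_eq\<close>)

section \<open>The norm form of a pure cubic field\<close>

text \<open>Write \<open>n = gcd n x * m\<close>. A common factor of \<open>m\<close> and
  \<open>x\<close> divides \<open>gcd n x\<close> as well, so its square divides \<open>n\<close>;
  hence \<open>m\<close> is coprime to \<open>x\<close> and, dividing \<open>x ^ k\<close>, a
  unit.\<close>

lemma squarefree_dvd_power_imp_dvd:
  fixes n x :: int
  assumes "squarefree n" "n dvd x ^ k"
  shows "n dvd x"
proof -
  obtain m where m: "n = gcd n x * m" by (metis dvdE gcd_dvd1)
  have "Rings.coprime m x"
  proof (rule ccontr)
    assume "\<not> Rings.coprime m x"
    then obtain l where l: "l dvd m" "l dvd x" "\<not> is_unit l" by (auto simp: Rings.coprime_def)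
    then have "l dvd n" using m by (metis dvd_mult)
    with l have "l dvd gcd n x" by simp
    with l m have "l ^ 2 dvd n" by (metis mult_dvd_mono power2_eq_square)
    with assms(1) l show False by (auto dest: squarefreeD)
  qed
  then have "Rings.coprime m (x ^ k)" by simp
  moreover have "m dvd x ^ k" using m assms(2) by (metis dvd_mult_right)
  ultimately have "is_unit m" by (meson coprime_common_divisor dvd_refl)
  then have "n dvd gcd n x" using m by (metis dvd_refl mult_unit_dvd_iff)
  then show ?thesis by simp
qed

lemma squarefree_int: "squarefree n \<Longrightarrow> squarefree (int n)"
proof (rule squarefreeI)
  fix x :: int assume n: "squarefree n" and "x\<^sup>2 dvd int n"
  then have "nat \<bar>x\<bar> ^ 2 dvd n"
    by (metis abs_dvd_iff int_dvd_int_iff nat_0_le abs_ge_zero of_nat_power power2_abs)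
  with n have "nat \<bar>x\<bar> dvd 1" by (rule squarefreeD)
  then show "x dvd 1" by auto
qed

text \<open>The norm of \<open>x + y u + z w\<close> where \<open>u ^ 3 = p q ^ 2\<close>,
  \<open>w ^ 3 = p ^ 2 q\<close> and \<open>u w = p q\<close>. It is generic because it serves over
  the integers for divisibility and over the reals for values.\<close>

definition norm_form :: "'a::comm_ring_1 \<Rightarrow> 'a \<Rightarrow> 'a \<Rightarrow> 'a \<Rightarrow> 'a \<Rightarrow> 'a" where
  "norm_form p q x y z = x ^ 3 + p * q ^ 2 * y ^ 3 + p ^ 2 * q * z ^ 3 - 3 * p * q * x * y * z"

lemma norm_form_scale: "norm_form p q (c * x) (c * y) (c * z) = c ^ 3 * norm_form p q x y z"
  by (simp add: norm_form_def algebra_simps power_mult_distrib power2_eq_square power3_eq_cube)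

lemma norm_form_swap: "norm_form p q x y z = norm_form q p x z y"
  by (simp add: norm_form_def algebra_simps)

section \<open>Congruences at the prime 3\<close>

lemma int_residue_cases3:
  fixes x :: int
  obtains a r where "x = r + 3 * a" "r \<in> {-1, 0, 1}"
proof -
  have "\<exists>a. x = 3 * a \<or> x = 1 + 3 * a \<or> x = -1 + 3 * a" by presburger
  then obtain a where "x = 3 * a \<or> x = 1 + 3 * a \<or> x = -1 + 3 * a" ..
  then show ?thesis using that[of 0 a] that[of 1 a] that[of "-1" a] by auto
qed

text \<open>An element of norm divisible by \<open>9\<close> lies in the square of the prime above \<open>3\<close>; modulo \<open>3\<close>
  that ideal is spanned by the coordinate vector \<open>(1, p, q)\<close>, whose norm is not divisible by \<open>27\<close>.\<close>

lemma norm_form_mod9_table: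
  "list_all (\<lambda>m. list_all (\<lambda>n. (m * n ^ 2) mod 9 \<in> {2, 4, 5, 7} \<longrightarrow>
     list_all (\<lambda>x. list_all (\<lambda>y. list_all (\<lambda>z.
       norm_form m n x y z mod 9 = 0 \<longrightarrow> (x - n * z) mod 3 = 0 \<and> (y - m * x) mod 3 = 0)
     [-1, 0, 1]) [-1, 0, 1]) [-1, 0, 1]) [0..8]) [0..8 :: int]"
  unfolding norm_form_def by code_simp

lemma norm_form_mod27_table:
  "list_all (\<lambda>m. list_all (\<lambda>n. (m * n ^ 2) mod 9 \<in> {2, 4, 5, 7} \<longrightarrow>
     norm_form m n 1 m n mod 27 \<noteq> 0) [0..26]) [0..26 :: int]"
  unfolding norm_form_def by code_simp

lemma norm_form_cong:
  fixes p q x y z :: int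
  assumes "[p = p'] (mod m)" "[q = q'] (mod m)" "[x = x'] (mod m)" "[y = y'] (mod m)" "[z = z'] (mod m)"
  shows "[norm_form p q x y z = norm_form p' q' x' y' z'] (mod m)"
  unfolding norm_form_def using assms
  by (intro cong_add cong_diff cong_mult cong_pow cong_refl)

text \<open>All partial derivatives of the form are divisible by 3, so moving the coordinates by
  multiples of 3 changes the value by a multiple of 9. Hence coordinates in
  \<open>{-1, 0, 1}\<close> suffice for the table modulo 9.\<close>

lemma norm_form_shift3:
  fixes p q x y z :: int
  shows "[norm_form p q (x + 3 * a) (y + 3 * b) (z + 3 * c) = norm_form p q x y z] (mod 9)"
proof -
  have "norm_form p q (x + 3 * a) (y + 3 * b) (z + 3 * c) - norm_form p q x y z =
    9 * (x ^ 2 * a + 3 * x * a ^ 2 + 3 * a ^ 3 + p * q ^ 2 * (y ^ 2 * b + 3 * y * b ^ 2 + 3 * b ^ 3)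
      + p ^ 2 * q * (z ^ 2 * c + 3 * z * c ^ 2 + 3 * c ^ 3)
      - p * q * (a * y * z + x * b * z + x * y * c + 3 * (a * b * z + a * y * c + x * b * c) + 9 * a * b * c))"
    unfolding norm_form_def by (simp add: algebra_simps power2_eq_square power3_eq_cube)
  then show ?thesis by (simp add: cong_iff_dvd_diff)
qed

lemma norm_form_9_dvd:
  fixes p q x y z :: int
  assumes pq: "(p * q ^ 2) mod 9 \<in> {2, 4, 5, 7}" and dvd: "9 dvd norm_form p q x y z"
  shows "3 dvd x - q * z" "3 dvd y - p * x"
proof -
  obtain a r where r: "x = r + 3 * a" "r \<in> {-1, 0, 1}" by (rule int_residue_cases3)
  obtain b s where s: "y = s + 3 * b" "s \<in> {-1, 0, 1}" by (rule int_residue_cases3)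
  obtain c t where t: "z = t + 3 * c" "t \<in> {-1, 0, 1}" by (rule int_residue_cases3)
  define m n where "m = p mod 9" and "n = q mod 9"
  have mn: "m \<in> {0..8}" "n \<in> {0..8}" by (auto simp: m_def n_def)
  have pm: "[p = m] (mod 9)" and qn: "[q = n] (mod 9)" by (auto simp: m_def n_def cong_def)
  have "[norm_form p q x y z = norm_form p q r s t] (mod 9)"
    unfolding r s t by (rule norm_form_shift3)
  also have "[norm_form p q r s t = norm_form m n r s t] (mod 9)"
    using pm qn by (intro norm_form_cong cong_refl)
  finally have z: "norm_form m n r s t mod 9 = 0" using dvd by (simp add: cong_def mod_eq_0_iff_dvd)
  have "[p * q ^ 2 = m * n ^ 2] (mod 9)" using pm qn by (intro cong_mult cong_pow)
  then have "(m * n ^ 2) mod 9 \<in> {2, 4, 5, 7}" using pq by (simp add: cong_def)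
  then have red: "(r - n * t) mod 3 = 0" "(s - m * r) mod 3 = 0"
    using norm_form_mod9_table[unfolded list_all_iff set_upto, rule_format, OF mn, of r s t]
      r(2) s(2) t(2) z by simp_all
  have p3: "[p = m] (mod 3)" and q3: "[q = n] (mod 3)"
    using pm qn by (auto intro: cong_dvd_modulus)
  have "[x = r] (mod 3)" "[y = s] (mod 3)" "[z = t] (mod 3)"
    unfolding r s t by (simp_all add: cong_iff_dvd_diff)
  with p3 q3 have "[x - q * z = r - n * t] (mod 3)" "[y - p * x = s - m * r] (mod 3)"
    by (auto intro!: cong_diff cong_mult)
  with red show "3 dvd x - q * z" "3 dvd y - p * x"
    by (simp_all add: cong_def mod_eq_0_iff_dvd)
qed

lemma square_mod3_if_not_dvd:
  fixes p :: int
  assumes "\<not> 3 dvd p"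
  obtains i where "p ^ 2 = 1 + 3 * i"
proof -
  obtain a r where r: "p = r + 3 * a" "r \<in> {-1, 0, 1}" by (rule int_residue_cases3)
  with assms have "r ^ 2 = 1" by auto
  then have "p ^ 2 = r ^ 2 + 3 * (2 * r * a + 3 * a ^ 2)"
    unfolding r(1) by (simp add: algebra_simps power2_eq_square power3_eq_cube)
  with \<open>r ^ 2 = 1\<close> show ?thesis by (metis that)
qed

lemma not_3_dvd_if_mod9:
  fixes p q :: int
  assumes "(p * q ^ 2) mod 9 \<in> {2, 4, 5, 7}"
  shows "\<not> 3 dvd p" "\<not> 3 dvd q"
proof -
  have "\<not> 3 dvd p * q ^ 2"
  proof
    assume "3 dvd p * q ^ 2"
    then have "3 dvd (p * q ^ 2) mod 9" by (simp add: dvd_mod)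
    with assms show False by auto
  qed
  then show "\<not> 3 dvd p" "\<not> 3 dvd q" by (auto simp: power2_eq_square)
qed

text \<open>Divisibility by 9 makes the vector \<open>r (1, p, q)\<close> modulo 3. The gradient of
  the form at \<open>(1, p, q)\<close> is divisible by 9, as \<open>p ^ 2\<close> and
  \<open>q ^ 2\<close> are 1 modulo 3, so modulo 27 the norm is that of \<open>r (1, p, q)\<close>,
  which is nonzero for \<open>r = 1\<close> and \<open>r = -1\<close>.\<close>

lemma norm_form_27_dvd:
  fixes p q x y z :: int
  assumes pq: "(p * q ^ 2) mod 9 \<in> {2, 4, 5, 7}" and dvd: "27 dvd norm_form p q x y z"
  shows "3 dvd x" "3 dvd y" "3 dvd z"
proof -
  have n3: "\<not> 3 dvd p" "\<not> 3 dvd q" using not_3_dvd_if_mod9[OF pq] by auto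
  have "9 dvd norm_form p q x y z" using dvd by (rule dvd_trans[rotated]) simp
  note red = norm_form_9_dvd[OF pq this]
  obtain i where i: "p ^ 2 = 1 + 3 * i" using square_mod3_if_not_dvd n3 by blast
  obtain j where j: "q ^ 2 = 1 + 3 * j" using square_mod3_if_not_dvd n3 by blast
  obtain a r where r: "x = r + 3 * a" "r \<in> {-1, 0, 1}" by (rule int_residue_cases3)
  have x: "3 dvd x"
  proof (rule ccontr)
    assume "\<not> 3 dvd x"
    then have r1: "r = 1 \<or> r = -1" using r by auto
    obtain k where k: "x - q * z = 3 * k" using red(1) by (rule dvdE)
    obtain l where l: "y - p * x = 3 * l" using red(2) by (rule dvdE)
    \<comment> \<open>\<open>b\<close> and \<open>c\<close> are the displacements from
      \<open>r (1, p, q)\<close> in units of 3. For \<open>c\<close>, the congruence of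
      \<open>x\<close> and \<open>q z\<close> is solved for \<open>z\<close> by multiplying with
      \<open>q\<close>, which is its own inverse modulo 3.\<close>
    define b where "b = p * a + l"
    define c where "c = q * a - q * k - j * z"
    have y: "y = r * p + 3 * b" using l unfolding b_def r(1) by (simp add: algebra_simps)
    have "x * q - 3 * k * q = q ^ 2 * z" using k by (simp add: algebra_simps power2_eq_square flip: k)
    then have z: "z = r * q + 3 * c" unfolding j r(1) c_def by (simp add: algebra_simps)
    \<comment> \<open>Taylor expansion at \<open>r (1, p, q)\<close>: first the linear terms, whose
      brackets contribute the missing factor 3, then the terms of higher order.\<close>
    have "norm_form p q x y z - r ^ 3 * norm_form p q 1 p q =
      9 * r ^ 2 * ((1 - p ^ 2 * q ^ 2) * a + p * q ^ 2 * (p ^ 2 - 1) * b + p ^ 2 * q * (q ^ 2 - 1) * c)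
      + 27 * (r * a ^ 2 + p ^ 2 * q ^ 2 * r * b ^ 2 + p ^ 2 * q ^ 2 * r * c ^ 2
        - p * q * r * (a * b * q + a * c * p + b * c)
        + a ^ 3 + p * q ^ 2 * b ^ 3 + p ^ 2 * q * c ^ 3 - 3 * p * q * a * b * c)"
      unfolding norm_form_def r(1) y z by (simp add: algebra_simps power2_eq_square power3_eq_cube)
    also have "1 - p ^ 2 * q ^ 2 = 3 * (- i - j - 3 * i * j)" unfolding i j by (simp add: algebra_simps)
    also have "p ^ 2 - 1 = 3 * i" using i by simp
    also have "q ^ 2 - 1 = 3 * j" using j by simp
    finally have "norm_form p q x y z - r ^ 3 * norm_form p q 1 p q =
      27 * (r ^ 2 * ((- i - j - 3 * i * j) * a + p * q ^ 2 * i * b + p ^ 2 * q * j * c)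
       + (r * a ^ 2 + p ^ 2 * q ^ 2 * r * b ^ 2 + p ^ 2 * q ^ 2 * r * c ^ 2
        - p * q * r * (a * b * q + a * c * p + b * c)
        + a ^ 3 + p * q ^ 2 * b ^ 3 + p ^ 2 * q * c ^ 3 - 3 * p * q * a * b * c))"
      by (simp add: algebra_simps power2_eq_square power3_eq_cube)
    then have "27 dvd norm_form p q x y z - r ^ 3 * norm_form p q 1 p q" by simp
    with dvd have "27 dvd r ^ 3 * norm_form p q 1 p q"
      by (metis dvd_diff_right_iff)
    then have d27: "27 dvd norm_form p q 1 p q" using r1 by auto
    define m n where "m = p mod 27" and "n = q mod 27"
    have mn: "m \<in> {0..26}" "n \<in> {0..26}" by (auto simp: m_def n_def)
    have pm: "[p = m] (mod 27)" and qn: "[q = n] (mod 27)" by (auto simp: m_def n_def cong_def)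
    have "[norm_form p q 1 p q = norm_form m n 1 m n] (mod 27)"
      using pm qn by (intro norm_form_cong cong_refl)
    then have "norm_form m n 1 m n mod 27 = 0" using d27 by (simp add: cong_def mod_eq_0_iff_dvd)
    moreover have "[p * q ^ 2 = m * n ^ 2] (mod 9)"
      using pm qn by (intro cong_mult cong_pow) (auto intro: cong_dvd_modulus)
    then have "(m * n ^ 2) mod 9 \<in> {2, 4, 5, 7}" using pq by (simp add: cong_def)
    ultimately show False
      using norm_form_mod27_table[unfolded list_all_iff set_upto, rule_format, OF mn] by simp
  qed
  show "3 dvd x" by (fact x)
  show "3 dvd y" using red(2) x by (metis dvd_mult dvd_diff_left_iff)
  have "3 dvd q * z" using red(1) x by (metis dvd_diff_right_iff)
  then show "3 dvd z" using n3 by (simp add: prime_dvd_mult_iff)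
qed

text \<open>As \<open>l\<close> divides \<open>p\<close> exactly once, the coefficients of
  \<open>x ^ 3\<close>, \<open>y ^ 3\<close>, \<open>z ^ 3\<close> contain \<open>l\<close> to the
  powers 0, 1, 2, up to factors prime to \<open>l\<close>. Divisibility by \<open>l\<close>,
  \<open>l ^ 2\<close>, \<open>l ^ 3\<close> therefore isolates \<open>x\<close>, \<open>y\<close>,
  \<open>z\<close> in turn.\<close>

lemma prime_cube_dvd_norm_form:
  fixes p q x y z l :: int
  assumes l: "Factorial_Ring.prime l" "l dvd p" "\<not> l ^ 2 dvd p" "\<not> l dvd q" and dvd: "l ^ 3 dvd norm_form p q x y z"
  shows "l dvd x" "l dvd y" "l dvd z"
proof -
  obtain e where e: "p = l * e" using l(2) by (rule dvdE)
  have le: "\<not> l dvd e" using l(3) by (auto simp: e power2_eq_square)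
  have l0: "l \<noteq> 0" using l(1) by auto
  have "l dvd norm_form p q x y z" using dvd by (rule dvd_trans[rotated]) simp
  moreover have "norm_form p q x y z = x ^ 3 + l * (e * q ^ 2 * y ^ 3 + e * p * q * z ^ 3 - 3 * e * q * x * y * z)"
    unfolding norm_form_def e by (simp add: algebra_simps power2_eq_square power3_eq_cube)
  ultimately have "l dvd x ^ 3" by (metis dvd_add_left_iff dvd_triv_left)
  then show x: "l dvd x" using l(1) prime_dvd_power by blast
  then obtain x' where x': "x = l * x'" by (rule dvdE)
  have "l ^ 2 dvd norm_form p q x y z"
    using dvd by (rule dvd_trans[rotated]) (simp add: le_imp_power_dvd)
  moreover have "norm_form p q x y z = l * (e * q ^ 2 * y ^ 3)
      + l ^ 2 * (l * x' ^ 3 + e ^ 2 * q * z ^ 3 - 3 * e * q * x' * y * z)"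
    unfolding norm_form_def e x' by (simp add: algebra_simps power2_eq_square power3_eq_cube)
  ultimately have "l ^ 2 dvd l * (e * q ^ 2 * y ^ 3)" by (metis dvd_add_left_iff dvd_triv_left)
  then have "l dvd e * q ^ 2 * y ^ 3" using l0 by (simp add: power2_eq_square)
  then show y: "l dvd y" using l le by (auto simp: prime_dvd_mult_iff dest: prime_dvd_power)
  then obtain y' where y': "y = l * y'" by (rule dvdE)
  have "norm_form p q x y z = l ^ 2 * (e ^ 2 * q * z ^ 3)
      + l ^ 3 * (x' ^ 3 + l * e * q ^ 2 * y' ^ 3 - 3 * e * q * x' * y' * z)"
    unfolding norm_form_def e x' y' by (simp add: algebra_simps power2_eq_square power3_eq_cube)
  with dvd have "l ^ 3 dvd l ^ 2 * (e ^ 2 * q * z ^ 3)" by (metis dvd_add_left_iff dvd_triv_left)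
  then have "l dvd e ^ 2 * q * z ^ 3" using l0 by (simp add: power2_eq_square power3_eq_cube)
  then show "l dvd z" using l le by (auto simp: prime_dvd_mult_iff dest: prime_dvd_power)
qed

text \<open>Modulo \<open>q\<close> only \<open>x ^ 3\<close> survives. Once \<open>q\<close>
  divides \<open>x\<close>, only \<open>q p ^ 2 z ^ 3\<close> survives modulo
  \<open>q ^ 2\<close>.\<close>

lemma square_dvd_norm_form:
  fixes p q x y z :: int
  assumes q: "squarefree q" and cop: "Rings.coprime p q"
  shows "q dvd norm_form p q x y z \<Longrightarrow> q dvd x"
    and "q ^ 2 dvd norm_form p q x y z \<Longrightarrow> q dvd z"
proof -
  show x: "q dvd x" if "q dvd norm_form p q x y z"
  proof -
    have "norm_form p q x y z = x ^ 3 + q * (p * q * y ^ 3 + p ^ 2 * z ^ 3 - 3 * p * x * y * z)"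
      unfolding norm_form_def by (simp add: algebra_simps power2_eq_square power3_eq_cube)
    with that have "q dvd x ^ 3" by (metis dvd_add_left_iff dvd_triv_left)
    with q show ?thesis by (rule squarefree_dvd_power_imp_dvd)
  qed
  assume q2: "q ^ 2 dvd norm_form p q x y z"
  then have "q dvd x" by (intro x) (auto elim: dvd_trans[rotated])
  then obtain x' where x': "x = q * x'" by (rule dvdE)
  have q0: "q \<noteq> 0" using q by auto
  have "norm_form p q x y z = q * (p ^ 2 * z ^ 3) + q ^ 2 * (q * x' ^ 3 + p * y ^ 3 - 3 * p * x' * y * z)"
    unfolding norm_form_def x' by (simp add: algebra_simps power2_eq_square power3_eq_cube)
  with q2 have "q ^ 2 dvd q * (p ^ 2 * z ^ 3)" by (metis dvd_add_left_iff dvd_triv_left)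
  then have "q dvd p ^ 2 * z ^ 3" using q0 by (simp add: power2_eq_square)
  moreover have "Rings.coprime q (p ^ 2)" using cop by (simp add: coprime_commute)
  ultimately have "q dvd z ^ 3" by (metis coprime_dvd_mult_right_iff)
  with q show "q dvd z" by (rule squarefree_dvd_power_imp_dvd)
qed

text \<open>The reason why \<open>1\<close>, \<open>q t\<close>, \<open>q t\<^sup>2\<close> is an integral basis: the trace form bounds the
  denominators by \<open>3 p q\<close>, and the norm excludes every prime divisor of that number.\<close>

lemma cube_dvd_norm_form:
  fixes p q :: int and D :: nat
  assumes "(p * q ^ 2) mod 9 \<in> {2, 4, 5, 7}" "squarefree p" "squarefree q" "Rings.coprime p q"
    and "D > 0" "\<And>l. Factorial_Ring.prime l \<Longrightarrow> l dvd D \<Longrightarrow> int l dvd 3 * p * q"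
    and "int D ^ 3 dvd norm_form p q x y z"
  shows "int D dvd x \<and> int D dvd y \<and> int D dvd z"
  using assms(5-)
proof (induction D arbitrary: x y z rule: less_induct)
  case (less D)
  show ?case
  proof (cases "D = 1")
    case False
    then obtain l where l: "Factorial_Ring.prime l" "l dvd D" using prime_factor_nat by blast
    then obtain D' where D': "D = l * D'" by (auto elim: dvdE)
    have l1: "l > 1" using l(1) by (rule prime_gt_1_nat)
    have D'0: "D' > 0" "D' < D" using less.prems(1) l1 by (auto simp: D')
    have pl: "Factorial_Ring.prime (int l)" using l(1) by simp
    have l3: "int l ^ 3 dvd norm_form p q x y z"
      using less.prems(3) by (rule dvd_trans[rotated]) (simp add: D' power_mult_distrib)
    have "int l dvd x \<and> int l dvd y \<and> int l dvd z"
    proof -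
      have sqf: "\<not> int l ^ 2 dvd n" if "squarefree n" for n
        using squarefreeD[OF that, of "int l"] l1 by auto
      have cop: "\<not> (int l dvd p \<and> int l dvd q)"
        using assms(4) l1 coprime_common_divisor by fastforce
      have "int l dvd 3 * p * q" using l less.prems(2) by blast
      then consider "int l dvd 3" | "int l dvd p" | "int l dvd q"
        using pl by (auto simp: prime_dvd_mult_iff)
      then show ?thesis
      proof cases
        case 1
        then have "l dvd 3" by presburger
        then have "l = 3" using l(1) primes_dvd_imp_eq[of l 3] by simp
        then show ?thesis using norm_form_27_dvd[OF assms(1)] l3 by simp
      next
        case 2
        then show ?thesis using prime_cube_dvd_norm_form[OF pl 2 _ _ l3] sqf assms(2) cop by blast
      next
        case 3
        \<comment> \<open>Exchanging \<open>p\<close> with \<open>q\<close> and \<open>y\<close>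
          with \<open>z\<close> reduces this case to the previous one.\<close>
        have "int l ^ 3 dvd norm_form q p x z y" using l3 by (simp add: norm_form_swap)
        moreover have "\<not> int l ^ 2 dvd q" "\<not> int l dvd p" using sqf[OF assms(3)] cop 3 by auto
        ultimately show ?thesis using prime_cube_dvd_norm_form[OF pl 3] by blast
      qed
    qed
    then obtain x' y' z' where xyz: "x = int l * x'" "y = int l * y'" "z = int l * z'"
      by (auto elim!: dvdE)
    have "int D' ^ 3 dvd norm_form p q x' y' z'"
      using less.prems(3) l1 unfolding xyz norm_form_scale D' by (simp add: power_mult_distrib)
    then have "int D' dvd x' \<and> int D' dvd y' \<and> int D' dvd z'"
      using less.prems(2) by (intro less.IH D'0) (auto simp: D')
    then show ?thesis by (auto simp: xyz D')
  qed simp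
qed

section \<open>Lattice points in a cylinder\<close>

text \<open>The squared absolute value of \<open>a + b \<omega> + c \<omega> ^ 2\<close> for a
  primitive cube root of unity \<open>\<omega>\<close>.\<close>

definition conj_form :: "real \<Rightarrow> real \<Rightarrow> real \<Rightarrow> real" where
  "conj_form a b c = a ^ 2 + b ^ 2 + c ^ 2 - a * b - a * c - b * c"

text \<open>Completing the square bounds \<open>a - (b + c) / 2\<close> by 3 in absolute value, and
  \<open>a\<close> is one third of the sum plus two thirds of this difference. The bounds 3 and 9
  describe the unit cylinder scaled by 3, which clears the denominators of the lattices.\<close>

lemma cylinder_bounds:
  assumes "0 \<le> a + b + c" "a + b + c < 3" "conj_form a b c < 9"
  shows "a \<in> {-2<..<3}" "b \<in> {-2<..<3}" "c \<in> {-2<..<3}"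
proof -
  have *: "a \<in> {-2<..<3}" if h: "0 \<le> a + b + c" "a + b + c < 3" "conj_form a b c < 9" for a b c
  proof -
    have "conj_form a b c = (a - (b + c) / 2) ^ 2 + 3 * ((b - c) / 2) ^ 2"
      by (simp add: conj_form_def power2_eq_square field_simps)
    moreover have "0 \<le> ((b - c) / 2) ^ 2" by (rule zero_le_power2)
    ultimately have "(a - (b + c) / 2) ^ 2 < 9" using h(3) by linarith
    then have "\<bar>a - (b + c) / 2\<bar> < 3" using power2_less_imp_less[of "\<bar>a - (b + c) / 2\<bar>" 3] by simp
    then have "-3 < a - (b + c) / 2" "a - (b + c) / 2 < 3" by linarith+
    then show ?thesis using h(1,2) by (simp add: field_simps)
  qed
  show "a \<in> {-2<..<3}" using * assms by blast
  have "conj_form b a c < 9" "conj_form c a b < 9"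
    using assms(3) by (simp_all add: conj_form_def algebra_simps)
  then show "b \<in> {-2<..<3}" "c \<in> {-2<..<3}"
    using assms *[of b a c] *[of c a b] by (auto simp: algebra_simps)
qed

text \<open>\<open>C1\<close> is the positive root of \<open>X ^ 2 + X - 8\<close>, the other root
  being \<open>- C1 - 1\<close>.\<close>

lemma C1_le_iff:
  assumes "0 < t"
  shows "C1 \<le> t \<longleftrightarrow> 8 \<le> t + t ^ 2"
proof -
  have C: "C1 ^ 2 + C1 = 8" "C1 > 0"
    unfolding C1_def by (auto simp: power2_eq_square field_simps)
  have "(t - C1) * (t + C1 + 1) = t + t ^ 2 - 8"
    using C(1) by (simp add: algebra_simps power2_eq_square)
  moreover have "0 \<le> t - C1 \<longleftrightarrow> 0 \<le> (t - C1) * (t + C1 + 1)"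
    using C(2) assms by (simp add: zero_le_mult_iff)
  ultimately show ?thesis by simp
qed

lemma Z_plus_le_iff:
  assumes "0 < t"
  shows "Z_plus \<le> t \<longleftrightarrow> 8 \<le> t ^ 4 + t ^ 3 + t"
proof -
  have Z: "Z_plus > 0" "Q4 Z_plus = 0"
    using theI'[OF Z_plus_ex1] unfolding Z_plus_def by auto
  have "Z_plus \<le> t \<longleftrightarrow> 0 \<le> Q4 t"
    using Q4_strict_mono[of Z_plus t] Q4_strict_mono[of t Z_plus] Z assms
    by (cases Z_plus t rule: linorder_cases) auto
  then show ?thesis by (simp add: Q4_def)
qed

lemma int_bounds_if_mult_bounds:
  fixes k :: int and r :: real
  assumes "of_int k * r \<in> {-2<..<3}" "1 \<le> r"
  shows "-1 \<le> k" "k \<le> 2" "3 / 2 \<le> r \<Longrightarrow> k \<le> 1" "2 \<le> r \<Longrightarrow> 0 \<le> k" "3 \<le> r \<Longrightarrow> k \<le> 0"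
proof -
  have upper: "k < m" if "3 \<le> of_int m * r" for m
  proof (rule ccontr)
    assume "\<not> k < m"
    then have "of_int m * r \<le> of_int k * r" using assms(2) by (intro mult_right_mono) auto
    with that assms(1) show False by auto
  qed
  have lower: "m < k" if "of_int m * r \<le> -2" for m
  proof (rule ccontr)
    assume "\<not> m < k"
    then have "of_int k * r \<le> of_int m * r" using assms(2) by (intro mult_right_mono) auto
    with that assms(1) show False by auto
  qed
  show "-1 \<le> k" using lower[of "-2"] assms(2) by simp
  show "k \<le> 2" using upper[of 3] assms(2) by simp
  show "3 / 2 \<le> r \<Longrightarrow> k \<le> 1" using upper[of 2] by simp
  show "2 \<le> r \<Longrightarrow> 0 \<le> k" using lower[of "-1"] by simp
  show "3 \<le> r \<Longrightarrow> k \<le> 0" using upper[of 1] by simp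
qed

text \<open>\<open>x\<close>, \<open>y\<close>, \<open>z\<close> are the coordinates of
  \<open>3 \<xi>\<close> along \<open>1\<close>, \<open>t\<close> and \<open>w\<close>, later
  \<open>q t ^ 2\<close>; \<open>s\<close> is the residue of \<open>p q\<close> modulo 3. The bounds
  leave \<open>z = 0\<close> and \<open>y\<close> in \<open>{0, 1}\<close>, and \<open>y = 0\<close>
  forces \<open>x = 0\<close> by the congruence.\<close>

lemma cylinder_empty_first:
  fixes x y z s n :: int and t w :: real
  assumes cyl: "0 \<le> x + y * t + z * w" "x + y * t + z * w < 3" "conj_form x (y * t) (z * w) < 9"
    and cong: "3 dvd x + s * y + n * z"
    and s: "s = 1 \<and> C1 \<le> t \<or> s = -1 \<and> 2 \<le> t" and t: "2 \<le> t" and w: "t ^ 2 \<le> w"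
  shows "x = 0 \<and> y = 0 \<and> z = 0"
proof -
  have "2 ^ 2 \<le> t ^ 2" using t by (intro power_mono) auto
  then have w3: "3 \<le> w" using w by simp
  note bounds = cylinder_bounds[OF cyl]
  have z: "z = 0" using int_bounds_if_mult_bounds[OF bounds(3)] w3 by simp
  have y: "y = 0 \<or> y = 1" using int_bounds_if_mult_bounds[OF bounds(2)] t by linarith
  have x: "-1 \<le> x" "x \<le> 2" using bounds(1) by auto
  show ?thesis
  proof (cases "y = 0")
    case True
    with cyl(1,2) cong z x show ?thesis by auto
  next
    case False
    then have y: "y = 1" using y by simp
    from s show ?thesis
    proof
      assume s: "s = 1 \<and> C1 \<le> t"
      \<comment> \<open>For \<open>x = -1\<close> the form is \<open>1 + t + t ^ 2\<close>, at least
        9 because \<open>C1 \<le> t\<close>; for \<open>x = 2\<close> the sum is too large.\<close>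
      then have "x = -1 \<or> x = 2" using cong x y z by simp presburger
      then show ?thesis
        using cyl C1_le_iff[of t] s t y z by (auto simp: conj_form_def)
    next
      assume s: "s = -1 \<and> 2 \<le> t"
      \<comment> \<open>The sum is now \<open>1 + t\<close>, which \<open>2 \<le> t\<close> keeps
        out of the cylinder.\<close>
      then have "x = 1" using cong x y z by simp presburger
      then show ?thesis using cyl(2) t y z by simp
    qed
  qed
qed

lemma cylinder_empty_second:
  fixes x y z s :: int and t :: real
  assumes cyl: "0 \<le> x + y * t + z * t ^ 2" "x + y * t + z * t ^ 2 < 3"
      "conj_form x (y * t) (z * t ^ 2) < 9"
    and cong: "3 dvd x - z" "3 dvd y - s * x"
    and s: "s = 1 \<or> s = -1 \<and> Z_plus \<le> t" and t: "1 < t"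
  shows "x = 0 \<and> y = 0 \<and> z = 0"
proof -
  have T: "t < t ^ 2" "t ^ 2 < t ^ 3" "t ^ 3 < t ^ 4"
    using t by (simp_all add: power_strict_increasing_iff[of t 1 2, simplified])
  \<comment> \<open>With the powers named, the form is linear in them for each concrete triple, so
    the remaining cases are linear arithmetic.\<close>
  define t2 t3 t4 where "t2 = t ^ 2" and "t3 = t ^ 3" and "t4 = t ^ 4"
  note T' = T[folded t2_def t3_def t4_def]
  have "conj_form x (y * t) (z * t ^ 2) =
      x ^ 2 + y ^ 2 * t2 + z ^ 2 * t4 - x * y * t - x * z * t2 - y * z * t3"
    unfolding t2_def t3_def t4_def
    by (simp add: conj_form_def power_mult_distrib power2_eq_square power3_eq_cube power4_eq_xxxx algebra_simps)
  with cyl have cyl': "0 \<le> x + y * t + z * t2" "x + y * t + z * t2 < 3"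
      "x ^ 2 + y ^ 2 * t2 + z ^ 2 * t4 - x * y * t - x * z * t2 - y * z * t3 < 9"
    unfolding t2_def by simp_all
  note bounds = cylinder_bounds[OF cyl]
  have y: "-1 \<le> y" "y \<le> 2" using int_bounds_if_mult_bounds[OF bounds(2)] t by auto
  have z: "-1 \<le> z" "z \<le> 2" using int_bounds_if_mult_bounds[OF bounds(3)] T t by auto
  have x: "-1 \<le> x" "x \<le> 2" using bounds(1) by auto
  from s show ?thesis
  proof
    assume "s = 1"
    \<comment> \<open>All three coordinates are congruent modulo 3. Nonzero triples of one sign
      violate the bounds on the sum; those of mixed sign give the form the value 9 at
      \<open>t = 1\<close> and more for \<open>t > 1\<close>.\<close>
    then have "(x = 0 \<and> y = 0 \<and> z = 0) \<or> (x = 1 \<and> y = 1 \<and> z = 1) \<or>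
       (x \<in> {-1, 2} \<and> y \<in> {-1, 2} \<and> z \<in> {-1, 2})"
      using x y z cong by simp presburger
    then show ?thesis
      using cyl' T' t by auto
  next
    assume s: "s = -1 \<and> Z_plus \<le> t"
    then have Z: "8 \<le> t ^ 4 + t ^ 3 + t" "1.4 < t"
      using Z_plus_le_iff[of t] Z_plus_approx t by (auto simp: abs_if split: if_splits)
    \<comment> \<open>The crude bound 1.4 is enough for \<open>t ^ 2 \<ge> 3 / 2\<close>, which
      excludes \<open>z = 2\<close>.\<close>
    have "1.4 ^ 2 \<le> t ^ 2" using Z(2) by (intro power_mono) auto
    then have "3 / 2 \<le> t ^ 2" by (simp add: power2_eq_square)
    then have "z \<le> 1" using int_bounds_if_mult_bounds[OF bounds(3)] by simp
    moreover have "3 dvd y + x" using cong(2) s by simp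
    \<comment> \<open>For \<open>(1, -1, 1)\<close> the form is
      \<open>t ^ 4 + t ^ 3 + t + 1\<close>, at least 9 because \<open>Z_plus \<le> t\<close>. For
      \<open>(2, 1, -1)\<close> it exceeds 9 as well, and the other two nonzero triples have a sum
      outside the allowed range.\<close>
    ultimately have "(x = 0 \<and> y = 0 \<and> z = 0) \<or> (x = 1 \<and> y \<in> {-1, 2} \<and> z = 1) \<or>
       (x \<in> {-1, 2} \<and> y = 1 \<and> z = -1)"
      using x y z cong(1) by simp presburger
    then show ?thesis
      using cyl' T' t Z[folded t3_def t4_def] by auto
  qed
qed

section \<open>Field automorphisms and integrality\<close>

text \<open>Transfer of the rules of \<open>generate_field\<close> from the record operations to
  those of the type class, with the convention \<open>inverse 0 = 0\<close>.\<close>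

lemma rat_adjoin_simps:
  fixes S :: "'a::field_char_0 set"
  shows rat_adjoin_1: "1 \<in> rat_adjoin S"
    and rat_adjoin_incl: "x \<in> S \<Longrightarrow> x \<in> rat_adjoin S"
    and rat_adjoin_uminus: "x \<in> rat_adjoin S \<Longrightarrow> - x \<in> rat_adjoin S"
    and rat_adjoin_add: "x \<in> rat_adjoin S \<Longrightarrow> y \<in> rat_adjoin S \<Longrightarrow> x + y \<in> rat_adjoin S"
    and rat_adjoin_mult: "x \<in> rat_adjoin S \<Longrightarrow> y \<in> rat_adjoin S \<Longrightarrow> x * y \<in> rat_adjoin S"
    and rat_adjoin_inverse: "x \<in> rat_adjoin S \<Longrightarrow> inverse x \<in> rat_adjoin S"
    and rat_adjoin_induct [consumes 1, case_names one incl uminus inverse add mult]: "x \<in> rat_adjoin S \<Longrightarrow> P 1 \<Longrightarrow> (\<And>h. h \<in> S \<Longrightarrow> P h) \<Longrightarrow>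
      (\<And>h. P h \<Longrightarrow> P (- h)) \<Longrightarrow> (\<And>h. P h \<Longrightarrow> h \<noteq> 0 \<Longrightarrow> P (inverse h)) \<Longrightarrow>
      (\<And>h k. P h \<Longrightarrow> P k \<Longrightarrow> P (h + k)) \<Longrightarrow> (\<And>h k. P h \<Longrightarrow> P k \<Longrightarrow> P (h * k)) \<Longrightarrow> P x"
proof -
  let ?R = "ring_of_type_algebra :: 'a ring"
  interpret R: Ring.field ?R by (rule field_from_type_algebra)
  have ops: "\<one>\<^bsub>?R\<^esub> = 1" "\<zero>\<^bsub>?R\<^esub> = 0" "x \<oplus>\<^bsub>?R\<^esub> y = x + y" "x \<otimes>\<^bsub>?R\<^esub> y = x * y" "carrier ?R = UNIV" for x y
    by (simp_all add: ring_of_type_algebra_def)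
  have um: "\<ominus>\<^bsub>?R\<^esub> x = - x" for x
    by (rule R.minus_equality) (simp_all add: ops)
  have inv: "inv\<^bsub>?R\<^esub> x = inverse x" if "x \<noteq> 0" for x
    using that by (intro R.comm_inv_char) (simp_all add: ops)
  show one: "1 \<in> rat_adjoin S" and "x \<in> S \<Longrightarrow> x \<in> rat_adjoin S"
    and "x \<in> rat_adjoin S \<Longrightarrow> - x \<in> rat_adjoin S"
    and add: "x \<in> rat_adjoin S \<Longrightarrow> y \<in> rat_adjoin S \<Longrightarrow> x + y \<in> rat_adjoin S"
    and "x \<in> rat_adjoin S \<Longrightarrow> y \<in> rat_adjoin S \<Longrightarrow> x * y \<in> rat_adjoin S" for x y
    using generate_field.intros[where R = ?R and H = S] unfolding rat_adjoin_def ops um by blast+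
  show "x \<in> rat_adjoin S \<Longrightarrow> inverse x \<in> rat_adjoin S" for x
    using generate_field.m_inv[where R = ?R and H = S and h = x] inv[of x]
    unfolding rat_adjoin_def ops by (cases "x = 0") auto
  show "P x" if "x \<in> rat_adjoin S" "P 1" "\<And>h. h \<in> S \<Longrightarrow> P h" "\<And>h. P h \<Longrightarrow> P (- h)"
    "\<And>h. P h \<Longrightarrow> h \<noteq> 0 \<Longrightarrow> P (inverse h)" "\<And>h k. P h \<Longrightarrow> P k \<Longrightarrow> P (h + k)"
    "\<And>h k. P h \<Longrightarrow> P k \<Longrightarrow> P (h * k)" for x P
    using that(1) unfolding rat_adjoin_def
    by (induction rule: generate_field.induct) (auto simp: ops um inv intro: that)
qed

lemma rat_adjoin_diff: "x \<in> rat_adjoin S \<Longrightarrow> y \<in> rat_adjoin S \<Longrightarrow> x - y \<in> rat_adjoin S"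
  using rat_adjoin_add[of x S "- y"] rat_adjoin_uminus[of y S] by simp

lemma rat_adjoin_divide: "x \<in> rat_adjoin S \<Longrightarrow> y \<in> rat_adjoin S \<Longrightarrow> x / y \<in> rat_adjoin S"
  using rat_adjoin_mult[of x S "inverse y"] rat_adjoin_inverse[of y S] by (simp add: field_simps)

lemma rat_adjoin_power: "x \<in> rat_adjoin S \<Longrightarrow> x ^ n \<in> rat_adjoin S"
  by (induction n) (auto intro: rat_adjoin_1 rat_adjoin_mult)

lemma Rats_subset_rat_adjoin: "x \<in> \<rat> \<Longrightarrow> x \<in> rat_adjoin S"
proof (induction rule: Rats_induct)
  case (of_rat r)
  have nat: "of_nat n \<in> rat_adjoin S" for n
  proof (induction n)
    case 0
    show ?case using rat_adjoin_diff[OF rat_adjoin_1 rat_adjoin_1, of S] by simp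
  qed (auto intro: rat_adjoin_add rat_adjoin_1)
  have int: "of_int k \<in> rat_adjoin S" for k
    using nat[of "nat \<bar>k\<bar>"] rat_adjoin_uminus[OF nat[of "nat \<bar>k\<bar>"]] by (cases "k \<ge> 0") auto
  obtain a b where "r = of_int a / of_int b" by (metis quotient_of_div surj_pair)
  then show ?case by (simp add: of_rat_divide rat_adjoin_divide int)
qed

locale field_aut =
  fixes K F :: "'a::field_char_0 set" and \<sigma> :: "'a \<Rightarrow> 'a" and S T :: "'a set"
  assumes K: "K = rat_adjoin S" and F: "F = rat_adjoin T" and gal: "\<sigma> \<in> Galois_group K F"
begin

lemma closed: "x \<in> K \<Longrightarrow> \<sigma> x \<in> K"
  and hom_add: "x \<in> K \<Longrightarrow> y \<in> K \<Longrightarrow> \<sigma> (x + y) = \<sigma> x + \<sigma> y"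
  and hom_mult: "x \<in> K \<Longrightarrow> y \<in> K \<Longrightarrow> \<sigma> (x * y) = \<sigma> x * \<sigma> y"
  and hom_Rats: "r \<in> \<rat> \<Longrightarrow> \<sigma> r = r"
  using gal Rats_subset_rat_adjoin[of r T]
  unfolding Galois_group_iff F[symmetric] by (auto simp: bij_betw_def)

lemma Rats_mem: "r \<in> \<rat> \<Longrightarrow> r \<in> K"
  and power_mem: "x \<in> K \<Longrightarrow> x ^ n \<in> K"
  unfolding K by (rule Rats_subset_rat_adjoin rat_adjoin_power, assumption)+

lemma hom_power: "x \<in> K \<Longrightarrow> \<sigma> (x ^ n) = \<sigma> x ^ n"
  unfolding K by (induction n) (auto simp: hom_Rats hom_mult[unfolded K] rat_adjoin_power)

lemma hom_sum: "(\<And>i. i \<in> I \<Longrightarrow> f i \<in> K) \<Longrightarrow> \<sigma> (\<Sum>i\<in>I. f i) = (\<Sum>i\<in>I. \<sigma> (f i)) \<and> (\<Sum>i\<in>I. f i) \<in> K"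
  by (induction I rule: infinite_finite_induct)
     (auto simp: hom_Rats hom_add K Rats_subset_rat_adjoin rat_adjoin_add)

text \<open>The automorphism fixes integer coefficients, so it maps a root of a monic integer
  polynomial to a root of the same polynomial.\<close>

lemma algebraic_int_hom:
  assumes "algebraic_int x" "x \<in> K"
  shows "algebraic_int (\<sigma> x)"
proof -
  obtain p where p: "poly (map_poly of_int p) x = 0" "Polynomial.lead_coeff p = 1"
    using assms(1) unfolding algebraic_int_altdef_ipoly by blast
  have "poly (map_poly of_int p) (\<sigma> x) = (\<Sum>i\<le>Polynomial.degree p. of_int (Polynomial.coeff p i) * \<sigma> x ^ i)"
    by (simp add: poly_altdef degree_map_poly coeff_map_poly)
  also have "\<dots> = (\<Sum>i\<le>Polynomial.degree p. \<sigma> (of_int (Polynomial.coeff p i) * x ^ i))"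
    using assms(2) by (intro sum.cong refl)
      (simp add: hom_mult hom_power hom_Rats Rats_mem power_mem)
  also have "\<dots> = \<sigma> (\<Sum>i\<le>Polynomial.degree p. of_int (Polynomial.coeff p i) * x ^ i)"
    using assms(2) by (intro hom_sum[THEN conjunct1, symmetric])
      (simp add: rat_adjoin_mult rat_adjoin_power K Rats_subset_rat_adjoin)
  also have "\<dots> = \<sigma> (poly (map_poly of_int p) x)"
    by (simp add: poly_altdef degree_map_poly coeff_map_poly)
  also have "\<dots> = 0" using p(1) by (simp add: hom_Rats)
  finally show ?thesis using p(2) unfolding algebraic_int_altdef_ipoly by blast
qed

end

section \<open>The maximal order of a pure cubic field\<close>

lemma conj_form_nonneg: "0 \<le> conj_form a b c"
  and conj_form_eq_0: "conj_form a b c = 0 \<Longrightarrow> a = b \<and> a = c"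
proof -
  have *: "2 * conj_form a b c = (a - b) ^ 2 + (a - c) ^ 2 + (b - c) ^ 2"
    by (simp add: conj_form_def power2_eq_square algebra_simps)
  have nn: "0 \<le> (a - b) ^ 2" "0 \<le> (a - c) ^ 2" "0 \<le> (b - c) ^ 2" by simp_all
  from * nn show "0 \<le> conj_form a b c" by linarith
  assume "conj_form a b c = 0"
  with * nn have "(a - b) ^ 2 = 0" "(a - c) ^ 2 = 0" by linarith+
  then show "a = b \<and> a = c" by simp
qed

lemma norm_form_of_int: "norm_form (of_int p) (of_int q) (of_int x) (of_int y) (of_int z) = of_int (norm_form p q x y z)"
  by (simp add: norm_form_def)

lemma cubic_mult:
  fixes p q u w :: "'a::comm_ring_1"
  assumes "u * u = q * w" "u * w = p * q" "w * w = p * u"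
  shows "(a + b * u + c * w) * (a' + b' * u + c' * w) =
    (a * a' + p * q * (b * c' + c * b')) + (a * b' + b * a' + p * (c * c')) * u + (a * c' + c * a' + q * (b * b')) * w"
proof -
  have "(a + b * u + c * w) * (a' + b' * u + c' * w) = a * a' + (a * b' + b * a') * u + (a * c' + c * a') * w
      + b * b' * (u * u) + (b * c' + c * b') * (u * w) + c * c' * (w * w)"
    by (simp add: algebra_simps)
  then show ?thesis unfolding assms by (simp add: algebra_simps)
qed

text \<open>The product of the two further conjugates again has explicit coordinates along
  \<open>1\<close>, \<open>u\<close>, \<open>w\<close>. It is the cofactor that multiplies an
  element to its norm and so provides inverses.\<close>

lemma cubic_conj_form:
  assumes "u * u = q * w" "u * w = p * q" "w * w = p * u"
  shows "conj_form a (b * u) (c * w) = (a ^ 2 - p * q * (b * c)) + (p * c ^ 2 - a * b) * u + (q * b ^ 2 - a * c) * w"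
proof -
  have "conj_form a (b * u) (c * w) = a ^ 2 - a * b * u - a * c * w + b ^ 2 * (u * u) + c ^ 2 * (w * w) - b * c * (u * w)"
    by (simp add: conj_form_def algebra_simps power2_eq_square)
  then show ?thesis unfolding assms by (simp add: algebra_simps)
qed

text \<open>The residues 2, 4, 5, 7 are \<open>\<plusminus>2\<close> and
  \<open>\<plusminus>4\<close> modulo 9, so \<open>d\<close> is prime to 3 and not
  \<open>\<plusminus>1\<close> modulo 9; this is what keeps the denominator 3 out of the integral
  basis.\<close>

locale pure_cubic =
  fixes p q d :: nat and \<zeta> :: complex and \<sigma> :: "complex \<Rightarrow> complex"
  assumes d: "d = p * q ^ 2"
    and sqf: "squarefree p" "squarefree q" and cop: "Rings.coprime p q" and less: "q < p"
    and mod9: "(int p * int q ^ 2) mod 9 \<in> {2, 4, 5, 7}"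
    and zeta: "\<zeta> ^ 3 = 1" "\<zeta> \<noteq> 1"
    and conjugation: "is_cubic_conjugation d \<zeta> \<sigma>"
begin

definition t :: real where "t = root 3 (real p / real q)"

text \<open>\<open>q t\<close> is the cube root of \<open>d = p q ^ 2\<close>, and
  \<open>q t ^ 2\<close> that of \<open>p ^ 2 q\<close>. Coordinates may be real; rationality is
  required where conjugates are taken.\<close>

definition elt :: "real \<Rightarrow> real \<Rightarrow> real \<Rightarrow> real" where
  "elt a b c = a + b * (q * t) + c * (q * t ^ 2)"

abbreviation "L \<equiv> pure_cubic_field d"

section \<open>Coordinates in the cubic field\<close>

lemma q_pos: "0 < q" and p_gt_1: "1 < p"
proof -
  show "0 < q" using sqf(2) by (cases q) auto
  then show "1 < p" using less by simp
qed

lemma t_cube: "q * t ^ 3 = p"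
  using q_pos by (simp add: t_def)

lemma t_gt_1: "1 < t"
  unfolding t_def using q_pos less by simp

lemma generator_products:
  "(q * t) * (q * t) = q * (q * t ^ 2)" "(q * t) * (q * t ^ 2) = real p * real q" "(q * t ^ 2) * (q * t ^ 2) = p * (q * t)"
proof -
  have t3: "t * t ^ 2 = t ^ 3" "t ^ 2 * t ^ 2 = t * t ^ 3"
    by (simp_all add: power2_eq_square power3_eq_cube)
  have "(q * t) * (q * t ^ 2) = q * (q * t ^ 3)" by (simp only: t3(1)[symmetric] mult_ac)
  then show "(q * t) * (q * t ^ 2) = real p * real q" unfolding t_cube by simp
  have "(q * t ^ 2) * (q * t ^ 2) = q * t * (q * t ^ 3)" using t3(2) by (simp add: mult_ac)
  then show "(q * t ^ 2) * (q * t ^ 2) = p * (q * t)" unfolding t_cube by (simp add: mult_ac)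
qed (simp add: power2_eq_square)

lemma generator_cubes: "(q * t) ^ 3 = p * q ^ 2" "(q * t ^ 2) ^ 3 = p ^ 2 * q"
proof -
  have "(q * t) ^ 3 = q ^ 2 * (q * t ^ 3)"
    by (simp add: power_mult_distrib power2_eq_square power3_eq_cube)
  then show "(q * t) ^ 3 = p * q ^ 2" unfolding t_cube by simp
  have "(q * t ^ 2) ^ 3 = q * (q * t ^ 3) ^ 2"
    by (simp add: power_mult_distrib power2_eq_square power3_eq_cube)
  then show "(q * t ^ 2) ^ 3 = p ^ 2 * q" unfolding t_cube by simp
qed

lemma root_eq: "root 3 (real d) = q * t"
  using t_gt_1 generator_cubes(1) by (intro real_root_pos_unique) (auto simp: d)

lemma elt_mult:
  "elt a b c * elt a' b' c' =
    elt (a * a' + real p * real q * (b * c' + c * b')) (a * b' + b * a' + real p * (c * c')) (a * c' + c * a' + real q * (b * b'))"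
  unfolding elt_def by (rule cubic_mult) (rule generator_products)+

lemma elt_linear:
  "elt a b c + elt a' b' c' = elt (a + a') (b + b') (c + c')"
  "- elt a b c = elt (- a) (- b) (- c)"
  "r * elt a b c = elt (r * a) (r * b) (r * c)"
  by (simp_all add: elt_def algebra_simps)

lemma conj_form_eq_elt:
  "conj_form a (b * (q * t)) (c * (q * t ^ 2)) = elt (a ^ 2 - real p * real q * (b * c)) (real p * c ^ 2 - a * b) (real q * b ^ 2 - a * c)"
  unfolding elt_def by (rule cubic_conj_form) (rule generator_products)+

lemma elt_mult_conj_form:
  "elt a b c * conj_form a (b * (q * t)) (c * (q * t ^ 2)) = norm_form (real p) (real q) a b c"
proof -
  have "elt a b c * conj_form a (b * (q * t)) (c * (q * t ^ 2)) = elt (norm_form (real p) (real q) a b c) 0 0"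
    unfolding conj_form_eq_elt elt_mult norm_form_def
    by (rule arg_cong3[where f = elt]) (simp_all add: algebra_simps power2_eq_square power3_eq_cube)
  then show ?thesis by (simp add: elt_def)
qed

text \<open>A rational \<open>q t\<close> would be an integer \<open>n\<close>, making
  \<open>(-n, 1, 0)\<close> a zero of the norm form; a prime divisor of \<open>p\<close> would then
  have to divide the coordinate 1.\<close>

lemma q_t_irrational: "q * t \<notin> \<rat>"
proof
  assume rat: "q * t \<in> \<rat>"
  have "algebraic_int ((q * t) ^ 3)" unfolding generator_cubes by (intro int_imp_algebraic_int) auto
  then have "q * t \<in> \<int>"
    using rat by (intro rational_algebraic_int_is_int) (auto dest: algebraic_int_if_power)
  then obtain n where n: "q * t = of_int n" by (auto elim: Ints_cases)
  have "real_of_int (n ^ 3) = real_of_int (int p * int q ^ 2)"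
    using generator_cubes(1) unfolding n by simp
  then have "n ^ 3 = int p * int q ^ 2" unfolding of_int_eq_iff .
  then have nf: "norm_form (int p) (int q) (- n) 1 0 = 0" by (simp add: norm_form_def)
  obtain l where l: "Factorial_Ring.prime l" "l dvd p" using p_gt_1 prime_factor_nat[of p] by auto
  have l1: "l > 1" using l(1) by (rule prime_gt_1_nat)
  have "\<not> int l dvd int q" using l cop l1 coprime_common_divisor[of p q l] by auto
  moreover have "\<not> int l ^ 2 dvd int p"
    using squarefreeD[OF squarefree_int[OF sqf(1)], of "int l"] l1 by auto
  ultimately have "int l dvd 1"
    using prime_cube_dvd_norm_form(2)[of "int l" "int p" "int q" "- n" 1 0] l nf by simp
  with l1 show False by simp
qed

lemma ex_eltI: "x = elt a b c \<Longrightarrow> a \<in> \<rat> \<Longrightarrow> b \<in> \<rat> \<Longrightarrow> c \<in> \<rat> \<Longrightarrow>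
    \<exists>a\<in>\<rat>. \<exists>b\<in>\<rat>. \<exists>c\<in>\<rat>. x = elt a b c"
  by blast

lemma field_closed:
  "x \<in> L \<Longrightarrow> y \<in> L \<Longrightarrow> x + y \<in> L" "x \<in> L \<Longrightarrow> y \<in> L \<Longrightarrow> x * y \<in> L"
  "x \<in> L \<Longrightarrow> y \<in> L \<Longrightarrow> x / y \<in> L" "x \<in> L \<Longrightarrow> x ^ n \<in> L" "r \<in> \<rat> \<Longrightarrow> r \<in> L"
  unfolding pure_cubic_field_def
  by (fact rat_adjoin_add rat_adjoin_mult rat_adjoin_divide rat_adjoin_power Rats_subset_rat_adjoin)+

lemma elt_in_field:
  assumes "a \<in> \<rat>" "b \<in> \<rat>" "c \<in> \<rat>"
  shows "elt a b c \<in> L"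
proof -
  have qt: "q * t \<in> L" by (simp add: pure_cubic_field_def root_eq rat_adjoin_incl)
  have "q * t ^ 2 = (1 / q) * (q * t) ^ 2" using q_pos by (simp add: power2_eq_square)
  moreover have "(1 / q) * (q * t) ^ 2 \<in> L"
    by (intro field_closed(2)[OF field_closed(5) field_closed(4)[OF qt]]) auto
  ultimately have qt2: "q * t ^ 2 \<in> L" by simp
  show ?thesis
    unfolding elt_def
    by (rule field_closed(1)[OF field_closed(1)[OF field_closed(5)[OF assms(1)] field_closed(2)[OF field_closed(5)[OF assms(2)] qt]]
          field_closed(2)[OF field_closed(5)[OF assms(3)] qt2]])
qed

text \<open>Only inverses need an idea: \<open>inverse h\<close> is the product of the two other
  conjugates of \<open>h\<close> divided by the norm, which does not vanish because
  \<open>q t\<close> is irrational.\<close>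

lemma field_iff: "x \<in> L \<longleftrightarrow> (\<exists>a\<in>\<rat>. \<exists>b\<in>\<rat>. \<exists>c\<in>\<rat>. x = elt a b c)"
proof
  assume "x \<in> L"
  then have "x \<in> rat_adjoin {q * t}" by (simp add: pure_cubic_field_def root_eq)
  then show "\<exists>a\<in>\<rat>. \<exists>b\<in>\<rat>. \<exists>c\<in>\<rat>. x = elt a b c"
  proof (induction rule: rat_adjoin_induct)
    case one
    show ?case by (intro bexI[of _ 1] bexI[of _ 0]) (auto simp: elt_def)
  next
    case (incl h)
    then show ?case by (intro bexI[of _ 0] bexI[of _ 1]) (auto simp: elt_def)
  next
    case (uminus h)
    then obtain a b c where abc: "a \<in> \<rat>" "b \<in> \<rat>" "c \<in> \<rat>" "h = elt a b c" by blast
    have "- h = elt (- a) (- b) (- c)" using abc(4) by (simp add: elt_linear)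
    then show ?case using abc by (meson Rats_minus_iff)
  next
    case (inverse h)
    then obtain a b c where abc: "a \<in> \<rat>" "b \<in> \<rat>" "c \<in> \<rat>" "h = elt a b c" by blast
    let ?N = "norm_form (real p) (real q) a b c" and ?C = "conj_form a (b * (q * t)) (c * (q * t ^ 2))"
    have hC: "h * ?C = ?N" unfolding abc(4) by (rule elt_mult_conj_form)
    have N0: "?N \<noteq> 0"
    proof
      assume "?N = 0"
      then have "?C = 0" using hC \<open>h \<noteq> 0\<close> by simp
      then have eq: "a = b * (q * t)" "a = c * (q * t ^ 2)" using conj_form_eq_0 by blast+
      have "b = 0"
      proof (rule ccontr)
        assume "b \<noteq> 0"
        then have "q * t = a / b" using eq(1) by simp
        then show False using q_t_irrational abc by auto
      qed
      then show False using eq abc(4) \<open>h \<noteq> 0\<close> by (simp add: elt_def)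
    qed
    then have "inverse h = inverse ?N * ?C" using hC \<open>h \<noteq> 0\<close> by (simp add: field_simps)
    moreover have "?N \<in> \<rat>" unfolding norm_form_def using abc by auto
    ultimately show ?case unfolding conj_form_eq_elt elt_linear using abc
      by - (rule ex_eltI, (assumption | rule Rats_mult Rats_diff Rats_power Rats_inverse Rats_of_nat)+)
  next
    case (add h k)
    from add(1) obtain a b c where h: "a \<in> \<rat>" "b \<in> \<rat>" "c \<in> \<rat>" "h = elt a b c" by blast
    from add(2) obtain a' b' c' where k: "a' \<in> \<rat>" "b' \<in> \<rat>" "c' \<in> \<rat>" "k = elt a' b' c'" by blast
    show ?case unfolding h(4) k(4) elt_linear by (intro ex_eltI[OF refl] Rats_add h(1-3) k(1-3))
  next
    case (mult h k)
    from mult(1) obtain a b c where h: "a \<in> \<rat>" "b \<in> \<rat>" "c \<in> \<rat>" "h = elt a b c" by blast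
    from mult(2) obtain a' b' c' where k: "a' \<in> \<rat>" "b' \<in> \<rat>" "c' \<in> \<rat>" "k = elt a' b' c'" by blast
    show ?case unfolding h(4) k(4) elt_mult
      by (intro ex_eltI[OF refl] Rats_mult Rats_add Rats_of_nat h(1-3) k(1-3))
  qed
qed (auto intro: elt_in_field)

section \<open>Conjugates of elements of the cubic field\<close>

abbreviation "K \<equiv> pure_cubic_closure d \<zeta>"

sublocale field_aut K "rat_adjoin {\<zeta>}" \<sigma> "complex_of_real ` L \<union> {\<zeta>}" "{\<zeta>}"
  using conjugation by unfold_locales (auto simp: pure_cubic_closure_def is_cubic_conjugation_def)

lemma of_real_mem: "x \<in> L \<Longrightarrow> complex_of_real x \<in> K"
  unfolding pure_cubic_closure_def by (intro rat_adjoin_incl) auto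

lemma zeta_mem: "\<zeta> \<in> K"
  unfolding pure_cubic_closure_def by (intro rat_adjoin_incl) auto

lemma hom_zeta: "\<sigma> \<zeta> = \<zeta>"
  using conjugation rat_adjoin_incl[of \<zeta> "{\<zeta>}"]
  by (auto simp: is_cubic_conjugation_def Galois_group_iff)

lemma K_closed: "x \<in> K \<Longrightarrow> y \<in> K \<Longrightarrow> x + y \<in> K" "x \<in> K \<Longrightarrow> y \<in> K \<Longrightarrow> x * y \<in> K"
  unfolding pure_cubic_closure_def by (fact rat_adjoin_add rat_adjoin_mult)+

lemma conj_mult:
  assumes "x \<in> L" "y \<in> L"
  shows "conj1 \<sigma> (x * y) = conj1 \<sigma> x * conj1 \<sigma> y" "conj2 \<sigma> (x * y) = conj2 \<sigma> x * conj2 \<sigma> y"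
  using assms by (simp_all add: conj1_def conj2_def hom_mult of_real_mem closed)

text \<open>\<open>\<sigma>\<close> fixes the rationals and \<open>\<zeta>\<close> and multiplies
  \<open>q t\<close> by \<open>\<zeta>\<close>. Since \<open>q t ^ 2\<close> is
  \<open>(q t) ^ 2 / q\<close>, it is multiplied by \<open>\<zeta> ^ 2\<close>.\<close>

lemma conj_elt:
  assumes "a \<in> \<rat>" "b \<in> \<rat>" "c \<in> \<rat>"
  shows "conj1 \<sigma> (elt a b c) = of_real a + of_real (b * (q * t)) * \<zeta> + of_real (c * (q * t ^ 2)) * \<zeta> ^ 2"
    and "conj2 \<sigma> (elt a b c) = of_real a + of_real (b * (q * t)) * \<zeta> ^ 2 + of_real (c * (q * t ^ 2)) * \<zeta>"
proof -
  let ?d = "complex_of_real (q * t)"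
  have d: "?d \<in> K" "\<sigma> ?d = \<zeta> * ?d"
    using conjugation elt_in_field[of 0 1 0] of_real_mem[of "q * t"] root_eq
    by (auto simp: is_cubic_conjugation_def elt_def)
  have R: "complex_of_real a \<in> \<rat>" "complex_of_real b \<in> \<rat>" "complex_of_real c \<in> \<rat>" "complex_of_real (c / q) \<in> \<rat>"
    using assms by (auto elim!: Rats_cases)
  note mem = Rats_mem[OF R(1)] Rats_mem[OF R(2)] Rats_mem[OF R(4)]
  have dd: "complex_of_real (c * (q * t ^ 2)) = of_real (c / q) * ?d ^ 2"
    using q_pos by (simp add: power2_eq_square)
  have eq: "complex_of_real (elt a b c) = of_real a + of_real b * ?d + of_real (c / q) * ?d ^ 2"
    unfolding elt_def of_real_add dd by simp
  \<comment> \<open>The free factor \<open>w\<close> lets one computation serve both conjugates,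
    with \<open>w = 1\<close> for the first and \<open>w = \<zeta>\<close> for the second.\<close>
  have h: "\<sigma> (of_real a + of_real b * (w * ?d) + of_real (c / q) * (w * ?d) ^ 2)
      = of_real a + of_real b * (\<sigma> w * (\<zeta> * ?d)) + of_real (c / q) * (\<sigma> w * (\<zeta> * ?d)) ^ 2" if "w \<in> K" for w
    using that d mem R by (simp only: hom_add hom_mult hom_power hom_Rats K_closed power_mem d(2))
  have z: "\<zeta> ^ 4 = \<zeta>" using zeta(1) by (simp add: power3_eq_cube power4_eq_xxxx)
  have one: "(1::complex) \<in> K" by (simp add: Rats_mem)
  have s1: "\<sigma> (of_real (elt a b c)) = of_real a + of_real b * (\<zeta> * ?d) + of_real (c / q) * (\<zeta> * ?d) ^ 2"
    using h[OF one] by (simp add: eq hom_Rats)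
  have s2: "\<sigma> (\<sigma> (of_real (elt a b c))) = of_real a + of_real b * (\<zeta> * (\<zeta> * ?d)) + of_real (c / q) * (\<zeta> * (\<zeta> * ?d)) ^ 2"
    unfolding s1 using h[OF zeta_mem] by (simp add: hom_zeta)
  show "conj1 \<sigma> (elt a b c) = of_real a + of_real (b * (q * t)) * \<zeta> + of_real (c * (q * t ^ 2)) * \<zeta> ^ 2"
    unfolding conj1_def s1 dd by (simp add: power_mult_distrib)
  have sq: "(\<zeta> * (\<zeta> * w)) ^ 2 = \<zeta> * w ^ 2" for w
  proof -
    have "(\<zeta> * (\<zeta> * w)) ^ 2 = \<zeta> ^ 4 * w ^ 2" by (simp add: power2_eq_square power4_eq_xxxx)
    then show ?thesis unfolding z .
  qed
  show "conj2 \<sigma> (elt a b c) = of_real a + of_real (b * (q * t)) * \<zeta> ^ 2 + of_real (c * (q * t ^ 2)) * \<zeta>"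
    unfolding conj2_def s2 dd sq by (simp add: power2_eq_square[of \<zeta>] mult_ac)
qed

lemma zeta_sum: "1 + \<zeta> + \<zeta> ^ 2 = 0"
proof -
  have "(\<zeta> - 1) * (1 + \<zeta> + \<zeta> ^ 2) = \<zeta> ^ 3 - 1"
    by (simp add: algebra_simps power2_eq_square power3_eq_cube)
  then show ?thesis using zeta by simp
qed

lemma conj_prod_elt:
  assumes "a \<in> \<rat>" "b \<in> \<rat>" "c \<in> \<rat>"
  shows "conj1 \<sigma> (elt a b c) * conj2 \<sigma> (elt a b c) = of_real (conj_form a (b * (q * t)) (c * (q * t ^ 2)))"
proof -
  have *: "(A + B * \<zeta> + C * \<zeta> ^ 2) * (A + B * \<zeta> ^ 2 + C * \<zeta>) =
     A ^ 2 + B ^ 2 + C ^ 2 - A * B - A * C - B * C" for A B C :: complex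
  proof -
    have z2: "\<zeta> ^ 2 = - 1 - \<zeta>" using zeta_sum by (simp add: eq_neg_iff_add_eq_0 algebra_simps)
    have zz: "\<zeta> * \<zeta> = - 1 - \<zeta>" using z2 by (simp add: power2_eq_square)
    have zz': "\<zeta> * (\<zeta> * w) = - w - \<zeta> * w" for w
      by (simp add: zz left_diff_distrib flip: mult.assoc)
    show ?thesis unfolding z2 by (simp add: algebra_simps power2_eq_square zz zz')
  qed
  show ?thesis unfolding conj_elt[OF assms] * by (simp add: conj_form_def)
qed

definition conj_prod :: "real \<Rightarrow> real" where
  "conj_prod x = Re (conj1 \<sigma> x * conj2 \<sigma> x)"

lemma conj_prod_elt':
  "a \<in> \<rat> \<Longrightarrow> b \<in> \<rat> \<Longrightarrow> c \<in> \<rat> \<Longrightarrow> conj_prod (elt a b c) = conj_form a (b * (q * t)) (c * (q * t ^ 2))"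
  by (simp add: conj_prod_def conj_prod_elt)

lemma of_real_conj_prod: "x \<in> L \<Longrightarrow> of_real (conj_prod x) = conj1 \<sigma> x * conj2 \<sigma> x"
  unfolding field_iff by (elim bexE) (simp only: conj_prod_elt conj_prod_elt')

lemma conj_prod_nonneg: "x \<in> L \<Longrightarrow> 0 \<le> conj_prod x"
  using conj_form_nonneg unfolding field_iff by (auto simp: conj_prod_elt')

lemma conj_prod_mult:
  assumes "x \<in> L" "y \<in> L"
  shows "conj_prod (x * y) = conj_prod x * conj_prod y"
proof -
  have xy: "x * y \<in> L" using assms unfolding pure_cubic_field_def by (rule rat_adjoin_mult)
  have "complex_of_real (conj_prod (x * y)) = of_real (conj_prod x * conj_prod y)"
    using assms xy by (simp add: of_real_conj_prod conj_mult)
  then show ?thesis using of_real_eq_iff by blast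
qed

lemma norm_elt:
  assumes "a \<in> \<rat>" "b \<in> \<rat>" "c \<in> \<rat>"
  shows "elt a b c * conj_prod (elt a b c) = norm_form (real p) (real q) a b c"
  using elt_mult_conj_form by (simp add: conj_prod_elt'[OF assms])

section \<open>Algebraic integers and the integral basis\<close>

abbreviation "OL \<equiv> maximal_order L"

lemma OL_iff: "x \<in> OL \<longleftrightarrow> x \<in> L \<and> algebraic_int x"
  by (simp add: maximal_order_def)

lemma OL_add: "x \<in> OL \<Longrightarrow> y \<in> OL \<Longrightarrow> x + y \<in> OL"
  and OL_mult: "x \<in> OL \<Longrightarrow> y \<in> OL \<Longrightarrow> x * y \<in> OL"
  by (simp_all add: OL_iff algebraic_int_add algebraic_int_mult field_closed)

lemma OL_Ints: "r \<in> \<int> \<Longrightarrow> r \<in> OL"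
  unfolding OL_iff using Ints_subset_Rats by (auto intro: field_closed int_imp_algebraic_int)

lemma OL_generators: "q * t \<in> OL" "q * t ^ 2 \<in> OL"
proof -
  have i: "algebraic_int ((q * t) ^ 3)" "algebraic_int ((q * t ^ 2) ^ 3)"
    unfolding generator_cubes by (intro int_imp_algebraic_int; auto)+
  show "q * t \<in> OL" "q * t ^ 2 \<in> OL"
    using elt_in_field[of 0 1 0] elt_in_field[of 0 0 1] algebraic_int_if_power[OF i(1)] algebraic_int_if_power[OF i(2)]
    by (auto simp: OL_iff elt_def)
qed

lemma elt_in_OL:
  assumes "a \<in> \<int>" "b \<in> \<int>" "c \<in> \<int>"
  shows "elt a b c \<in> OL"
  unfolding elt_def using assms by (intro OL_add OL_mult OL_Ints OL_generators)

lemma of_real_Int: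
  assumes "algebraic_int (complex_of_real x)" "x \<in> \<rat>"
  shows "x \<in> \<int>"
  using assms by (auto intro: rational_algebraic_int_is_int)

lemma conj_algebraic_int:
  assumes "x \<in> OL"
  shows "algebraic_int (complex_of_real x)" "algebraic_int (conj1 \<sigma> x)" "algebraic_int (conj2 \<sigma> x)"
  using assms by (auto simp: OL_iff conj1_def conj2_def closed of_real_mem intro!: algebraic_int_hom)

text \<open>In the trace the terms with \<open>q t\<close> and \<open>q t ^ 2\<close> cancel because
  \<open>1 + \<zeta> + \<zeta> ^ 2 = 0\<close>.\<close>

lemma trace_Ints:
  assumes "elt a b c \<in> OL" "a \<in> \<rat>" "b \<in> \<rat>" "c \<in> \<rat>"
  shows "3 * a \<in> \<int>"
proof -
  let ?x = "elt a b c"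
  have "complex_of_real ?x + conj1 \<sigma> ?x + conj2 \<sigma> ?x =
    of_real (3 * a) + (of_real (b * (q * t)) + of_real (c * (q * t ^ 2))) * (1 + \<zeta> + \<zeta> ^ 2)"
    unfolding conj_elt[OF assms(2-)] by (simp add: elt_def algebra_simps)
  then have "complex_of_real ?x + conj1 \<sigma> ?x + conj2 \<sigma> ?x = of_real (3 * a)" by (simp add: zeta_sum)
  moreover have "algebraic_int (complex_of_real ?x + conj1 \<sigma> ?x + conj2 \<sigma> ?x)"
    using conj_algebraic_int[OF assms(1)] by (intro algebraic_int_add)
  ultimately show ?thesis using assms(2) by (intro of_real_Int) auto
qed

lemma norm_Ints:
  assumes "x \<in> OL"
  shows "x * conj_prod x \<in> \<int>"
proof (rule of_real_Int)
  have x: "x \<in> L" using assms by (simp add: OL_iff)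
  show "algebraic_int (complex_of_real (x * conj_prod x))"
    using conj_algebraic_int[OF assms] by (simp add: of_real_conj_prod[OF x] algebraic_int_mult)
  from x obtain a b c where "a \<in> \<rat>" "b \<in> \<rat>" "c \<in> \<rat>" "x = elt a b c" unfolding field_iff by blast
  then show "x * conj_prod x \<in> \<rat>" by (simp add: norm_elt) (simp add: norm_form_def)
qed

lemma OL_elt:
  assumes x: "x \<in> OL"
  shows "\<exists>i j k :: int. x = elt (of_int i) (of_int j) (of_int k)"
proof -
  obtain a b c where abc: "a \<in> \<rat>" "b \<in> \<rat>" "c \<in> \<rat>" "x = elt a b c"
    using x unfolding OL_iff field_iff by blast
  define D where "D = 3 * p * q"
  have 1: "3 * a \<in> \<int>" using x abc by (auto intro: trace_Ints)
  \<comment> \<open>Multiplication by \<open>q t\<close> or \<open>q t ^ 2\<close> moves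
    \<open>c\<close> or \<open>b\<close>, times \<open>p q\<close>, into the constant coordinate,
    where the trace detects it.\<close>
  have "x * (q * t) = elt (real p * real q * c) a (real q * b)"
    using elt_mult[of a b c 0 1 0] abc(4) by (simp add: elt_def[of 0 1 0])
  moreover have "x * (q * t ^ 2) = elt (real p * real q * b) (real p * c) a"
    using elt_mult[of a b c 0 0 1] abc(4) by (simp add: elt_def[of 0 0 1])
  ultimately have "elt (real p * real q * c) a (real q * b) \<in> OL" "elt (real p * real q * b) (real p * c) a \<in> OL"
    using OL_mult[OF x] OL_generators by metis+
  then have "3 * (real p * real q * c) \<in> \<int>" "3 * (real p * real q * b) \<in> \<int>"
    using abc by (auto intro: trace_Ints)
  then have "D * a \<in> \<int>" "D * b \<in> \<int>" "D * c \<in> \<int>"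
    using Ints_mult[OF 1, of "real p * real q"] by (simp_all add: D_def mult_ac)
  then obtain i j k where ijk: "D * a = of_int i" "D * b = of_int j" "D * c = of_int k"
    by (auto elim!: Ints_cases)
  obtain n where n: "norm_form (real p) (real q) a b c = of_int n"
    using norm_Ints[OF x] unfolding abc(4) norm_elt[OF abc(1-3)] by (auto elim: Ints_cases)
  have "of_int (norm_form (int p) (int q) i j k) = norm_form (real p) (real q) (D * a) (D * b) (D * c)"
    unfolding ijk by (simp flip: norm_form_of_int)
  also have "\<dots> = of_int (int D ^ 3 * n)" unfolding norm_form_scale n by simp
  finally have "int D ^ 3 dvd norm_form (int p) (int q) i j k" unfolding of_int_eq_iff by simp
  moreover have D: "D > 0" using q_pos p_gt_1 by (simp add: D_def)
  moreover have "int l dvd 3 * int p * int q" if "l dvd D" for l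
    using that by (metis D_def int_dvd_int_iff of_nat_mult of_nat_numeral)
  ultimately have "int D dvd i \<and> int D dvd j \<and> int D dvd k"
    using mod9 sqf cop by (intro cube_dvd_norm_form) (simp_all add: squarefree_int)
  then obtain i' j' k' where "i = int D * i'" "j = int D * j'" "k = int D * k'" by (auto elim!: dvdE)
  then have "a = of_int i'" "b = of_int j'" "c = of_int k'" using ijk D by simp_all
  then show ?thesis using abc(4) by blast
qed

end

section \<open>The lattices of a principal factor\<close>

text \<open>By Fermat cubes can be replaced by their bases modulo 3, and \<open>p ^ 2\<close> and
  \<open>q ^ 2\<close> by 1, so the norm form becomes linear.\<close>

lemma norm_form_3_dvd:
  fixes p q x y z :: int
  assumes "\<not> 3 dvd p" "\<not> 3 dvd q" "3 dvd norm_form p q x y z"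
  shows "3 dvd x + p * y + q * z"
proof -
  have fermat: "3 dvd w ^ 3 - w" for w :: int
  proof -
    obtain a r where "w = r + 3 * a" "r \<in> {-1, 0, 1}" by (rule int_residue_cases3)
    then have "w ^ 3 - w = 3 * (3 * r ^ 2 * a + 9 * r * a ^ 2 + 9 * a ^ 3 - a)"
      by (auto simp: algebra_simps power2_eq_square power3_eq_cube)
    then show ?thesis by simp
  qed
  obtain i where i: "p ^ 2 = 1 + 3 * i" using square_mod3_if_not_dvd assms(1) by blast
  obtain j where j: "q ^ 2 = 1 + 3 * j" using square_mod3_if_not_dvd assms(2) by blast
  have "norm_form p q x y z - (x + p * y + q * z) = (x ^ 3 - x) + p * q ^ 2 * (y ^ 3 - y) + p * (q ^ 2 - 1) * y
      + p ^ 2 * q * (z ^ 3 - z) + q * (p ^ 2 - 1) * z - 3 * (p * q * x * y * z)"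
    by (simp add: norm_form_def algebra_simps)
  also have "\<dots> = (x ^ 3 - x) + p * q ^ 2 * (y ^ 3 - y) + p ^ 2 * q * (z ^ 3 - z)
      + 3 * (p * j * y + q * i * z - p * q * x * y * z)"
    unfolding i j by (simp add: algebra_simps)
  finally have eq: "norm_form p q x y z - (x + p * y + q * z) =
    (x ^ 3 - x) + p * q ^ 2 * (y ^ 3 - y) + p ^ 2 * q * (z ^ 3 - z)
      + 3 * (p * j * y + q * i * z - p * q * x * y * z)" .
  have "3 dvd norm_form p q x y z - (x + p * y + q * z)"
    unfolding eq by (intro dvd_add dvd_triv_left dvd_mult fermat)
  with assms(3) show ?thesis by (metis dvd_diff_right_iff)
qed

lemma conj_form_divide: "conj_form (a / r) (b / r) (c / r) = conj_form a b c / r ^ 2"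
  by (simp add: conj_form_def power_divide power2_eq_square diff_divide_distrib add_divide_distrib)

context pure_cubic
begin

lemma three_not_dvd: "\<not> 3 dvd int p" "\<not> 3 dvd int q"
  using not_3_dvd_if_mod9[OF mod9] by auto

lemma conj_prod_of_rat: "r \<in> \<rat> \<Longrightarrow> conj_prod r = r ^ 2"
  using conj_prod_elt'[of r 0 0] by (simp add: elt_def conj_form_def)

text \<open>The substitution \<open>\<beta> = a \<xi>\<close> turns the cylinder of \<open>a\<close>
  into the unit cylinder, because \<open>conj_prod\<close> is multiplicative and positive at
  \<open>a\<close>.\<close>

lemma in_lattice_minima_iff:
  assumes a: "a \<in> OL" "0 < a"
  shows "a \<in> lattice_minima \<sigma> OL \<longleftrightarrow>
    (\<forall>\<xi>\<in>L. a * \<xi> \<in> OL \<longrightarrow> 0 \<le> \<xi> \<longrightarrow> \<xi> < 1 \<longrightarrow> conj_prod \<xi> < 1 \<longrightarrow> \<xi> = 0)"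
proof -
  have aL: "a \<in> L" using a by (simp add: OL_iff)
  have nz: "conj_prod a \<noteq> 0"
  proof
    assume "conj_prod a = 0"
    moreover have "conj_prod a * conj_prod (1 / a) = conj_prod 1"
      using a by (subst conj_prod_mult[OF aL field_closed(3)[OF field_closed(5) aL], symmetric]) auto
    ultimately show False by (simp add: conj_prod_of_rat)
  qed
  with conj_prod_nonneg[OF aL] have cpos: "0 < conj_prod a" by simp
  have cp: "conj_prod (a * \<xi>) < conj_prod a \<longleftrightarrow> conj_prod \<xi> < 1" if "\<xi> \<in> L" for \<xi>
    using cpos aL that by (simp add: conj_prod_mult)
  show ?thesis
  proof
    assume m: "a \<in> lattice_minima \<sigma> OL"
    show "\<forall>\<xi>\<in>L. a * \<xi> \<in> OL \<longrightarrow> 0 \<le> \<xi> \<longrightarrow> \<xi> < 1 \<longrightarrow> conj_prod \<xi> < 1 \<longrightarrow> \<xi> = 0"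
    proof (intro ballI impI)
      fix \<xi> assume xi: "\<xi> \<in> L" "a * \<xi> \<in> OL" "0 \<le> \<xi>" "\<xi> < 1" "conj_prod \<xi> < 1"
      then have "0 \<le> a * \<xi>" "a * \<xi> < a" "conj_prod (a * \<xi>) < conj_prod a" using a by (simp_all add: cp)
      with m xi(2) have "a * \<xi> = 0" unfolding lattice_minima_def conj_prod_def by blast
      then show "\<xi> = 0" using a by simp
    qed
  next
    assume r: "\<forall>\<xi>\<in>L. a * \<xi> \<in> OL \<longrightarrow> 0 \<le> \<xi> \<longrightarrow> \<xi> < 1 \<longrightarrow> conj_prod \<xi> < 1 \<longrightarrow> \<xi> = 0"
    have "b = 0" if b: "b \<in> OL" "conj_prod b < conj_prod a" "0 \<le> b" "b < a" for b
    proof -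
      have bL: "b / a \<in> L" using b(1) aL by (simp add: OL_iff field_closed(3))
      have ab: "a * (b / a) = b" using a by simp
      have "b / a = 0" using r[rule_format, OF bL, unfolded ab] cp[OF bL, unfolded ab] a b by simp
      then show ?thesis using a by simp
    qed
    then show "a \<in> lattice_minima \<sigma> OL" using a unfolding lattice_minima_def conj_prod_def by auto
  qed
qed

end

locale pure_cubic_factor = pure_cubic +
  fixes \<alpha> :: real
  assumes factor: "principal_factor d \<zeta> \<sigma> \<alpha>" and norm: "cubic_norm \<sigma> \<alpha> = of_nat (9 * q)"
begin

definition \<epsilon> :: real where "\<epsilon> = \<alpha> ^ 3 / (9 * q)"

text \<open>The second principal factor of the theorem; the prime does not denote a conjugate
  here.\<close>

definition \<alpha>' :: real where "\<alpha>' = \<alpha> ^ 2 / 3"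

section \<open>The principal factor and its unit\<close>

lemma alpha_OL: "\<alpha> \<in> OL"
  using factor by (simp add: principal_factor_def Let_def)

lemma alpha_field: "\<alpha> \<in> L" "\<alpha>' \<in> L"
proof -
  show "\<alpha> \<in> L" using alpha_OL by (simp add: OL_iff)
  then show "\<alpha>' \<in> L" unfolding \<alpha>'_def
    by (intro field_closed(3)[OF field_closed(4) field_closed(5)]) auto
qed

lemma norm_alpha: "\<alpha> * conj_prod \<alpha> = 9 * q"
proof -
  have "complex_of_real (\<alpha> * conj_prod \<alpha>) = of_real (9 * q)"
    using norm by (simp add: of_real_conj_prod[OF alpha_field(1)] cubic_norm_def mult.assoc)
  then show ?thesis unfolding of_real_eq_iff .
qed

lemma alpha_pos: "0 < \<alpha>" "0 < \<alpha>'"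
proof -
  have "0 < \<alpha> * conj_prod \<alpha>" unfolding norm_alpha using q_pos by simp
  then show "0 < \<alpha>" using conj_prod_nonneg[OF alpha_field(1)] by (simp add: zero_less_mult_iff)
  then show "0 < \<alpha>'" by (simp add: \<alpha>'_def)
qed

lemma alpha_cube: "\<alpha> ^ 3 = 9 * q * \<epsilon>" "\<alpha>' ^ 3 = 3 * q ^ 2 * \<epsilon> ^ 2" "\<alpha> * \<alpha>' = 3 * q * \<epsilon>"
proof -
  show a: "\<alpha> ^ 3 = 9 * q * \<epsilon>" using q_pos by (simp add: \<epsilon>_def)
  have "\<alpha>' ^ 3 = (\<alpha> ^ 3) ^ 2 / 27" by (simp add: \<alpha>'_def power_divide flip: power_mult)
  then show "\<alpha>' ^ 3 = 3 * q ^ 2 * \<epsilon> ^ 2" unfolding a by (simp add: power_mult_distrib)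
  have "\<alpha> * \<alpha>' = \<alpha> ^ 3 / 3" by (simp add: \<alpha>'_def power2_eq_square power3_eq_cube)
  then show "\<alpha> * \<alpha>' = 3 * q * \<epsilon>" unfolding a by simp
qed

lemma epsilon_pos: "0 < \<epsilon>"
  using alpha_pos q_pos by (simp add: \<epsilon>_def)

text \<open>Invariance of the ideal provides integral \<open>u\<close> and \<open>v\<close> with
  \<open>\<sigma> \<alpha> = \<alpha> u\<close> and \<open>\<alpha> = \<sigma> (\<alpha> v)\<close>.
  Comparing \<open>\<alpha> ^ 3\<close> with the norm \<open>9 q\<close> expresses
  \<open>\<epsilon>\<close> as a product of conjugates of \<open>v\<close>, and its inverse as
  \<open>u ^ 2 \<sigma> u\<close>.\<close>

lemma epsilon_unit: "\<epsilon> \<in> OL" "inverse \<epsilon> \<in> OL"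
proof -
  let ?a = "complex_of_real \<alpha>" and ?I = "principal_ideal (complex_of_real \<alpha>) (maximal_order K)"
  have inv: "\<sigma> ` ?I = ?I" using factor by (simp add: principal_factor_def Let_def)
  have aK: "?a \<in> K" using alpha_field by (simp add: of_real_mem)
  have "1 \<in> maximal_order K" by (auto simp: maximal_order_def Rats_mem)
  then have aI: "?a \<in> ?I" unfolding principal_ideal_def by force
  then have "\<sigma> ?a \<in> ?I" using inv by blast
  then obtain u where u: "u \<in> maximal_order K" "\<sigma> ?a = ?a * u" by (auto simp: principal_ideal_def)
  have "?a \<in> \<sigma> ` ?I" unfolding inv by (rule aI)
  then obtain v where v: "v \<in> maximal_order K" "?a = \<sigma> (?a * v)" by (auto simp: principal_ideal_def)
  have uK: "u \<in> K" "algebraic_int u" and vK: "v \<in> K" "algebraic_int v"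
    using u v by (simp_all add: maximal_order_def)
  have v1: "?a = \<sigma> ?a * \<sigma> v" using v(2) hom_mult[OF aK vK(1)] by simp
  then have v2: "\<sigma> ?a = \<sigma> (\<sigma> ?a) * \<sigma> (\<sigma> v)"
    using hom_mult[OF closed[OF aK] closed[OF vK(1)]] by simp
  have u2: "\<sigma> (\<sigma> ?a) = \<sigma> ?a * \<sigma> u" using u(2) hom_mult[OF aK uK(1)] by simp
  have N: "of_real (9 * q) = ?a * \<sigma> ?a * \<sigma> (\<sigma> ?a)"
    using norm by (simp add: cubic_norm_def conj1_def conj2_def)
  have a0: "?a \<noteq> 0" using alpha_pos by simp
  have q0: "of_real (9 * q) \<noteq> (0 :: complex)" using q_pos by simp
  have "?a ^ 3 = ?a * (\<sigma> ?a * \<sigma> v) * (\<sigma> (\<sigma> ?a) * \<sigma> (\<sigma> v) * \<sigma> v)"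
    unfolding v1[symmetric] v2[symmetric] by (simp add: power3_eq_cube mult_ac)
  then have "?a ^ 3 = of_real (9 * q) * (\<sigma> v * \<sigma> v * \<sigma> (\<sigma> v))"
    unfolding N by (simp add: mult_ac)
  then have eps: "complex_of_real \<epsilon> = \<sigma> v * \<sigma> v * \<sigma> (\<sigma> v)"
    using q0 unfolding \<epsilon>_def by (simp add: field_simps)
  have "of_real (9 * q) = ?a ^ 3 * (u * u * \<sigma> u)"
    unfolding N u2 unfolding u(2) by (simp add: power3_eq_cube mult_ac)
  then have eps': "complex_of_real (inverse \<epsilon>) = u * u * \<sigma> u"
    using a0 unfolding \<epsilon>_def by (simp add: field_simps)
  have "algebraic_int (complex_of_real \<epsilon>)" "algebraic_int (complex_of_real (inverse \<epsilon>))"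
    unfolding eps eps' using uK vK by (auto intro!: algebraic_int_mult algebraic_int_hom closed)
  then have alg: "algebraic_int \<epsilon>" "algebraic_int (inverse \<epsilon>)" unfolding algebraic_int_of_real_iff .
  have "\<epsilon> \<in> L"
    unfolding \<epsilon>_def
    by (intro field_closed(3)[OF field_closed(4)[OF alpha_field(1)] field_closed(5)]) auto
  moreover have "1 / \<epsilon> \<in> L" by (intro field_closed(3)[OF field_closed(5) \<open>\<epsilon> \<in> L\<close>]) auto
  ultimately show "\<epsilon> \<in> OL" "inverse \<epsilon> \<in> OL" using alg by (simp_all add: OL_iff inverse_eq_divide)
qed

text \<open>Cubing replaces \<open>\<alpha>\<close> and \<open>\<alpha>'\<close> by an integer times
  a power of the unit \<open>\<epsilon>\<close>, and an element whose cube is an algebraic integer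
  is one itself.\<close>

lemma witness_OL:
  fixes x :: real
  assumes "x \<in> L"
  shows "9 * real q * x ^ 3 \<in> OL \<Longrightarrow> \<alpha> * x \<in> OL" and "3 * real q ^ 2 * x ^ 3 \<in> OL \<Longrightarrow> \<alpha>' * x \<in> OL"
proof -
  show "\<alpha> * x \<in> OL" if "9 * real q * x ^ 3 \<in> OL"
  proof -
    have "(\<alpha> * x) ^ 3 = (9 * real q * x ^ 3) * \<epsilon>" by (simp add: power_mult_distrib alpha_cube)
    then have "algebraic_int ((\<alpha> * x) ^ 3)" using OL_mult[OF that epsilon_unit(1)] by (simp add: OL_iff)
    then show ?thesis using assms alpha_field by (simp add: OL_iff algebraic_int_if_power field_closed)
  qed
  show "\<alpha>' * x \<in> OL" if "3 * real q ^ 2 * x ^ 3 \<in> OL"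
  proof -
    have "(\<alpha>' * x) ^ 3 = (3 * real q ^ 2 * x ^ 3) * (\<epsilon> * \<epsilon>)"
      by (simp add: power_mult_distrib alpha_cube power2_eq_square)
    then have "algebraic_int ((\<alpha>' * x) ^ 3)"
      using OL_mult[OF that OL_mult[OF epsilon_unit(1) epsilon_unit(1)]] by (simp add: OL_iff)
    then show ?thesis using assms alpha_field by (simp add: OL_iff algebraic_int_if_power field_closed)
  qed
qed

lemma alpha'_OL: "\<alpha>' \<in> OL"
  using witness_OL(2)[of 1] by (simp add: field_closed OL_Ints)

lemma norm_alpha': "\<alpha>' * conj_prod \<alpha>' = 3 * q ^ 2"
proof -
  have aa: "\<alpha> * \<alpha> \<in> L" using alpha_field(1) by (simp add: field_closed(2))
  have third: "1 / 3 \<in> L" "conj_prod (1 / 3) = (1 / 3) ^ 2"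
    by (rule field_closed(5) conj_prod_of_rat, simp)+
  have "conj_prod \<alpha>' = conj_prod (\<alpha> * \<alpha> * (1 / 3))" by (simp add: \<alpha>'_def power2_eq_square)
  also have "\<dots> = conj_prod \<alpha> ^ 2 / 9"
    unfolding conj_prod_mult[OF aa third(1)] conj_prod_mult[OF alpha_field(1) alpha_field(1)] third(2)
    by (simp add: power2_eq_square)
  finally have "\<alpha>' * conj_prod \<alpha>' = (\<alpha> * conj_prod \<alpha>) ^ 2 / 27"
    by (simp add: \<alpha>'_def power_mult_distrib)
  then show ?thesis unfolding norm_alpha by (simp add: power_mult_distrib)
qed

text \<open>The common part of both lattices: \<open>a\<close> and \<open>b\<close> are
  \<open>\<alpha>\<close> and \<open>\<alpha>'\<close> in either order. Since
  \<open>3 q \<xi>\<close> is \<open>b\<close> times the integral element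
  \<open>a \<xi> / \<epsilon>\<close>, its norm is a multiple of the norm \<open>m\<close> of
  \<open>b\<close>.\<close>

lemma elt_of_factor:
  assumes "a \<in> OL" "b \<in> OL" "a * b = 3 * q * \<epsilon>" "b * conj_prod b = of_int m" and xi: "a * \<xi> \<in> OL"
  obtains i j k :: int where "\<xi> = elt i j k / (3 * q)" "m dvd norm_form (int p) (int q) i j k"
proof -
  let ?c = "a * \<xi> * inverse \<epsilon>"
  have c: "?c \<in> OL" using xi epsilon_unit(2) by (rule OL_mult)
  have eq: "?c * b = 3 * q * \<xi>"
    using assms(3) epsilon_pos by (simp add: field_simps)
  obtain i j k :: int where ijk: "?c * b = elt i j k" using OL_elt[OF OL_mult[OF c assms(2)]] by blast
  obtain n where n: "?c * conj_prod ?c = of_int n" using norm_Ints[OF c] by (auto elim: Ints_cases)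
  have "real_of_int (norm_form (int p) (int q) i j k) = norm_form (real p) (real q) i j k"
    by (simp flip: norm_form_of_int)
  also have "\<dots> = (?c * b) * conj_prod (?c * b)" unfolding ijk by (simp add: norm_elt)
  also have "\<dots> = (?c * conj_prod ?c) * (b * conj_prod b)"
    using c assms(2) by (simp add: conj_prod_mult OL_iff)
  also have "\<dots> = of_int (n * m)" unfolding n assms(4) by simp
  finally have "m dvd norm_form (int p) (int q) i j k" unfolding of_int_eq_iff by simp
  moreover have "\<xi> = elt i j k / (3 * q)" using eq ijk q_pos by simp
  ultimately show ?thesis by (rule that[rotated])
qed

text \<open>The norm of \<open>3 q \<xi>\<close> is divisible by \<open>3 q ^ 2\<close>: the factor
  \<open>q ^ 2\<close> allows \<open>q\<close> to be cancelled from the first and third coordinates,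
  and the factor 3 gives the congruence.\<close>

lemma first_lattice:
  assumes "\<alpha> * \<xi> \<in> OL"
  obtains x y z :: int where "3 * \<xi> = x + y * t + z * (q * t ^ 2)"
    "9 * conj_prod \<xi> = conj_form x (y * t) (z * (q * t ^ 2))" "3 dvd x + int p * int q * y + int q * z"
proof -
  have m: "\<alpha>' * conj_prod \<alpha>' = of_int (3 * int q ^ 2)" using norm_alpha' by simp
  obtain i j k :: int where ijk: "\<xi> = elt i j k / (3 * q)"
    and dvd: "3 * int q ^ 2 dvd norm_form (int p) (int q) i j k"
    using elt_of_factor[OF alpha_OL alpha'_OL alpha_cube(3) m assms] by blast
  have q2: "int q ^ 2 dvd norm_form (int p) (int q) i j k" and d3: "3 dvd norm_form (int p) (int q) i j k"
    using dvd by (auto elim: dvd_mult_left dvd_mult_right)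
  have q1: "int q dvd norm_form (int p) (int q) i j k" using q2 by (auto elim: dvd_trans[rotated])
  have sq: "squarefree (int q)" "Rings.coprime (int p) (int q)"
    using sqf cop by (simp_all add: squarefree_int)
  obtain x where x: "i = int q * x" using square_dvd_norm_form(1)[OF sq q1] by (rule dvdE)
  obtain z where z: "k = int q * z" using square_dvd_norm_form(2)[OF sq q2] by (rule dvdE)
  have xi: "\<xi> = elt (x / 3) (j / q / 3) (z / 3)"
    unfolding ijk x z elt_def using q_pos by (simp add: field_simps)
  have qq: "j / q / 3 * (q * t) = j * t / 3" using q_pos by simp
  obtain l where l: "int q ^ 2 = 1 + 3 * l" using square_mod3_if_not_dvd three_not_dvd by blast
  \<comment> \<open>The extra factor \<open>q\<close> produces squares of \<open>q\<close>, which
    are 1 modulo 3, and so absorbs the \<open>q\<close> split off from \<open>i\<close> and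
    \<open>k\<close>.\<close>
  have "3 dvd int q * (i + int p * j + int q * k)"
    using norm_form_3_dvd[OF three_not_dvd d3] by simp
  also have "int q * (i + int p * j + int q * k) = int q ^ 2 * x + int p * int q * j + int q ^ 2 * int q * z"
    unfolding x z by (simp add: algebra_simps power2_eq_square)
  also have "\<dots> = (x + int p * int q * j + int q * z) + 3 * (l * x + l * int q * z)"
    unfolding l by (simp add: algebra_simps)
  finally have "3 dvd x + int p * int q * j + int q * z" by (metis dvd_add_left_iff dvd_triv_left)
  moreover have "3 * \<xi> = x + j * t + z * (q * t ^ 2)" unfolding xi elt_def qq by (simp add: field_simps)
  moreover have "conj_prod \<xi> = conj_form (x / 3) (j * t / 3) (z * (q * t ^ 2) / 3)"
    unfolding xi using q_pos by (subst conj_prod_elt') simp_all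
  then have "9 * conj_prod \<xi> = conj_form x (j * t) (z * (q * t ^ 2))" unfolding conj_form_divide by simp
  ultimately show ?thesis using that by blast
qed

text \<open>Now the norm of \<open>3 q \<xi>\<close> is divisible by \<open>9 q\<close>: the single
  \<open>q\<close> can be cancelled from the first coordinate only, but the factor 9 gives two
  congruences.\<close>

lemma second_lattice:
  assumes "\<alpha>' * \<xi> \<in> OL"
  obtains x y z :: int where "3 * \<xi> = x + y * t + z * t ^ 2"
    "9 * conj_prod \<xi> = conj_form x (y * t) (z * t ^ 2)" "3 dvd x - z" "3 dvd y - int p * int q * x"
proof -
  have m: "\<alpha> * conj_prod \<alpha> = of_int (9 * int q)" using norm_alpha by simp
  obtain i j k :: int where ijk: "\<xi> = elt i j k / (3 * q)"
    and dvd: "9 * int q dvd norm_form (int p) (int q) i j k"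
    using elt_of_factor[OF alpha'_OL alpha_OL _ m assms] alpha_cube(3) by (auto simp: mult.commute)
  have q1: "int q dvd norm_form (int p) (int q) i j k" and d9: "9 dvd norm_form (int p) (int q) i j k"
    using dvd by (auto elim: dvd_mult_left dvd_mult_right)
  have sq: "squarefree (int q)" "Rings.coprime (int p) (int q)"
    using sqf cop by (simp_all add: squarefree_int)
  obtain x where x: "i = int q * x" using square_dvd_norm_form(1)[OF sq q1] by (rule dvdE)
  have xi: "\<xi> = elt (x / 3) (j / q / 3) (k / q / 3)"
    unfolding ijk x elt_def using q_pos by (simp add: field_simps)
  have qq: "j / q / 3 * (q * t) = j * t / 3" "k / q / 3 * (q * t ^ 2) = k * t ^ 2 / 3"
    using q_pos by simp_all
  note red = norm_form_9_dvd[OF mod9 d9]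
  have "i - int q * k = int q * (x - k)" unfolding x by (simp add: algebra_simps)
  with red(1) three_not_dvd have "3 dvd x - k" by (simp add: prime_dvd_mult_iff)
  moreover have "3 dvd j - int p * int q * x" using red(2) unfolding x by (simp add: mult_ac)
  moreover have "3 * \<xi> = x + j * t + k * t ^ 2" unfolding xi elt_def qq by (simp add: field_simps)
  moreover have "conj_prod \<xi> = conj_form (x / 3) (j * t / 3) (k * t ^ 2 / 3)"
    unfolding xi using q_pos by (subst conj_prod_elt') simp_all
  then have "9 * conj_prod \<xi> = conj_form x (j * t) (k * t ^ 2)" unfolding conj_form_divide by simp
  ultimately show ?thesis using that by blast
qed

text \<open>\<open>s\<close> replaces \<open>p q\<close> in the congruence of the lattice, so that
  the cylinder contains no nonzero lattice point.\<close>

lemma alpha_minimum: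
  assumes s: "s = 1 \<and> C1 \<le> t \<or> s = -1 \<and> 2 \<le> t" and ps: "3 dvd int p * int q - s"
  shows "\<alpha> \<in> lattice_minima \<sigma> OL"
  unfolding in_lattice_minima_iff[OF alpha_OL alpha_pos(1)]
proof (intro ballI impI)
  fix \<xi> assume xi: "\<alpha> * \<xi> \<in> OL" "0 \<le> \<xi>" "\<xi> < 1" "conj_prod \<xi> < 1"
  obtain x y z :: int where xyz: "3 * \<xi> = x + y * t + z * (q * t ^ 2)"
    "9 * conj_prod \<xi> = conj_form x (y * t) (z * (q * t ^ 2))" "3 dvd x + int p * int q * y + int q * z"
    using first_lattice[OF xi(1)] .
  have "x + int p * int q * y + int q * z = (x + s * y + int q * z) + (int p * int q - s) * y"
    by (simp add: algebra_simps)
  then have "3 dvd x + s * y + int q * z" using xyz(3) ps by (metis dvd_add_left_iff dvd_mult2)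
  \<comment> \<open>In the case \<open>s = 1\<close> this holds because \<open>t < 2\<close> would
    give \<open>t + t ^ 2 < 6\<close>, against \<open>C1 \<le> t\<close>.\<close>
  moreover have t2: "2 \<le> t"
  proof (rule ccontr)
    assume "\<not> 2 \<le> t"
    then have "t ^ 2 < 2 ^ 2" using t_gt_1 by (intro power_strict_mono) auto
    then show False using C1_le_iff[of t] s t_gt_1 \<open>\<not> 2 \<le> t\<close> by auto
  qed
  moreover have "t ^ 2 \<le> q * t ^ 2" using mult_right_mono[of 1 "real q" "t ^ 2"] q_pos by simp
  ultimately have "x = 0 \<and> y = 0 \<and> z = 0"
    using xyz(1,2) xi s
    by (intro cylinder_empty_first[where w = "q * t ^ 2" and n = "int q" and s = s and t = t]) auto
  then show "\<xi> = 0" using xyz(1) by simp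
qed

lemma alpha'_minimum:
  assumes s: "s = 1 \<or> s = -1 \<and> Z_plus \<le> t" and ps: "3 dvd int p * int q - s"
  shows "\<alpha>' \<in> lattice_minima \<sigma> OL"
  unfolding in_lattice_minima_iff[OF alpha'_OL alpha_pos(2)]
proof (intro ballI impI)
  fix \<xi> assume xi: "\<alpha>' * \<xi> \<in> OL" "0 \<le> \<xi>" "\<xi> < 1" "conj_prod \<xi> < 1"
  obtain x y z :: int where xyz: "3 * \<xi> = x + y * t + z * t ^ 2"
    "9 * conj_prod \<xi> = conj_form x (y * t) (z * t ^ 2)" "3 dvd x - z" "3 dvd y - int p * int q * x"
    using second_lattice[OF xi(1)] .
  have eq: "y - s * x = (y - int p * int q * x) + (int p * int q - s) * x" by (simp add: algebra_simps)
  have "3 dvd y - s * x" unfolding eq using xyz(4) ps by (intro dvd_add dvd_mult2)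
  then have "x = 0 \<and> y = 0 \<and> z = 0"
    using xyz(1-3) xi s t_gt_1 by (intro cylinder_empty_second) auto
  then show "\<xi> = 0" using xyz(1) by simp
qed

text \<open>The witness \<open>(t - s) / 3\<close> belongs to the lattice because
  \<open>q (t - s) ^ 3\<close> has constant term \<open>p - s q\<close>, a multiple of 3 like its
  other coordinates.\<close>

lemma alpha_not_minimum:
  assumes s: "s = 1 \<and> t < C1 \<or> s = -1 \<and> t < 2" and ps: "3 dvd int p - s * int q"
  shows "\<alpha> \<notin> lattice_minima \<sigma> OL"
proof -
  let ?x = "(t - s) / 3"
  obtain m where m: "int p - s * int q = 3 * m" using ps by (rule dvdE)
  then have m': "real p - s * real q = 3 * m"
    by (metis of_int_diff of_int_mult of_int_numeral of_int_of_nat_eq)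
  have s2: "s * s = 1" "real_of_int s * real_of_int s = 1" using s by auto
  have x: "?x = elt (- s / 3) (1 / q / 3) 0" using q_pos by (simp add: elt_def field_simps)
  have xL: "?x \<in> L" unfolding x by (intro elt_in_field) auto
  have "9 * real q * ?x ^ 3 = q * (t - s) ^ 3 / 3" by (simp add: power_divide)
  also have "q * (t - s) ^ 3 = q * t ^ 3 - 3 * s * (q * t ^ 2) + 3 * (s * s) * (q * t) - (s * s) * s * q"
    by (simp add: power2_eq_square power3_eq_cube algebra_simps)
  also have "\<dots> / 3 = elt m 1 (- s)"
    unfolding t_cube s2 elt_def using m' by (simp add: field_simps)
  finally have "9 * real q * ?x ^ 3 \<in> OL" by (simp add: elt_in_OL)
  then have "\<alpha> * ?x \<in> OL" by (rule witness_OL(1)[OF xL])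
  moreover have "conj_prod ?x = conj_form (- s / 3) (t / 3) (0 / 3)"
    unfolding x using q_pos by (subst conj_prod_elt') auto
  then have "9 * conj_prod ?x = 1 + t ^ 2 + s * t"
    unfolding conj_form_divide using s2 by (simp add: conj_form_def power2_eq_square)
  moreover have "t ^ 2 < 4" if "t < 2" using that t_gt_1 power_strict_mono[of t 2 2] by simp
  \<comment> \<open>For \<open>s = 1\<close> the conjugate bound is the binding one and amounts to
    \<open>t < C1\<close>; for \<open>s = -1\<close> it is the size of the witness, which is below 1
    exactly for \<open>t < 2\<close>.\<close>
  then have "1 + t ^ 2 + s * t < 9" "t < 3 + s"
    using s C1_le_iff[of t] t_gt_1 power2_less_imp_less[of 0 t] self_le_power[of t 2]
    by (auto simp: not_le)
  ultimately show ?thesis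
    unfolding in_lattice_minima_iff[OF alpha_OL alpha_pos(1)] using xL s t_gt_1 by force
qed

lemma alpha'_not_minimum:
  assumes t: "t < Z_plus" and ps: "3 dvd int p + int q"
  shows "\<alpha>' \<notin> lattice_minima \<sigma> OL"
proof -
  let ?x = "(1 - t + t ^ 2) / 3"
  obtain m where m: "int p + int q = 3 * m" using ps by (rule dvdE)
  then have m': "real p = 3 * m - real q"
    by (metis add_diff_cancel_right' of_int_add of_int_mult of_int_numeral of_int_of_nat_eq)
  have x: "?x = elt (1 / 3) (- 1 / q / 3) (1 / q / 3)" using q_pos by (simp add: elt_def field_simps)
  have xL: "?x \<in> L" unfolding x by (intro elt_in_field) auto
  have "3 * real q ^ 2 * ?x ^ 3 = q ^ 2 * (1 - t + t ^ 2) ^ 3 / 9" by (simp add: power_divide)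
  also have "q ^ 2 * (1 - t + t ^ 2) ^ 3 = (q * t ^ 3) ^ 2 - 7 * q * (q * t ^ 3) + q ^ 2
      + (6 * (q * t ^ 3) - 3 * q) * (q * t) + (6 * q - 3 * (q * t ^ 3)) * (q * t ^ 2)"
    by (simp add: power2_eq_square power3_eq_cube algebra_simps)
  \<comment> \<open>All coordinates are divisible by 9 once \<open>p = 3 m - q\<close> is inserted;
    for instance the constant one, \<open>p ^ 2 - 7 p q + q ^ 2\<close>, is
    \<open>(p + q) ^ 2 - 9 p q\<close>.\<close>
  also have "\<dots> / 9 = elt (m ^ 2 - real p * real q) (2 * m - q) (q - m)"
    unfolding t_cube elt_def m' by (simp add: field_simps power2_eq_square)
  finally have "3 * real q ^ 2 * ?x ^ 3 \<in> OL" by (simp add: elt_in_OL)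
  then have "\<alpha>' * ?x \<in> OL" by (rule witness_OL(2)[OF xL])
  moreover have "conj_prod ?x = conj_form (1 / 3) (- t / 3) (t ^ 2 / 3)"
    unfolding x using q_pos by (subst conj_prod_elt') auto
  then have "9 * conj_prod ?x = t ^ 4 + t ^ 3 + t + 1"
    unfolding conj_form_divide
    by (simp add: conj_form_def power2_eq_square power3_eq_cube power4_eq_xxxx)
  moreover have "t ^ 4 + t ^ 3 + t < 8" using Z_plus_le_iff[of t] t t_gt_1 by simp
  \<comment> \<open>This places the witness below 1, as \<open>1 - t + t ^ 2 < 3\<close> means
    \<open>(t - 2) (t + 1) < 0\<close>.\<close>
  moreover have "t < 2" using t Z_plus_approx by (auto simp: abs_if split: if_splits)
  then have "t * t < t * 2" "t * 1 < t * t" using t_gt_1 by (intro mult_strict_left_mono; simp)+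
  then have "t ^ 2 < 2 * t" "t < t ^ 2" by (simp_all only: power2_eq_square mult_1_right mult.commute)
  then have "0 < ?x" "?x < 1" using t_gt_1 \<open>t < 2\<close> by simp_all
  ultimately show ?thesis
    unfolding in_lattice_minima_iff[OF alpha'_OL alpha_pos(2)] using xL by force
qed

section \<open>The criteria according to residues modulo 3\<close>

lemma less_cube_iff:
  assumes "0 \<le> c"
  shows "real p < c ^ 3 * real q \<longleftrightarrow> t < c"
proof -
  have "real p < c ^ 3 * real q \<longleftrightarrow> t ^ 3 < c ^ 3" using q_pos by (simp add: mult.commute flip: t_cube)
  also have "\<dots> \<longleftrightarrow> t < c" using assms t_gt_1 by (simp add: power_mono_iff flip: not_le)
  finally show ?thesis .
qed

text \<open>Here \<open>p q\<close> is congruent to \<open>q ^ 2\<close>, hence to 1, modulo 3, so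
  the criteria apply with \<open>s = 1\<close>.\<close>

lemma minima_if_same_residue:
  assumes "[int p = int q] (mod 3)"
  shows "\<alpha> \<in> lattice_minima \<sigma> OL \<longleftrightarrow> C1 ^ 3 * real q \<le> real p" "\<alpha>' \<in> lattice_minima \<sigma> OL"
proof -
  obtain l where l: "int q ^ 2 = 1 + 3 * l" using square_mod3_if_not_dvd three_not_dvd by blast
  have pq: "3 dvd int p - int q" using assms by (simp add: cong_iff_dvd_diff)
  have "int p * int q - 1 = (int p - int q) * int q + 3 * l"
    using l by (simp add: algebra_simps power2_eq_square)
  then have s: "3 dvd int p * int q - 1" using pq by simp
  have "0 \<le> C1" by (simp add: C1_def)
  then have "C1 ^ 3 * real q \<le> real p \<longleftrightarrow> C1 \<le> t" using less_cube_iff[of C1] by (simp flip: not_less)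
  then show "\<alpha> \<in> lattice_minima \<sigma> OL \<longleftrightarrow> C1 ^ 3 * real q \<le> real p"
    using alpha_minimum[of 1] alpha_not_minimum[of 1] s pq by (auto simp: not_le)
  show "\<alpha>' \<in> lattice_minima \<sigma> OL" using alpha'_minimum[of 1] s by simp
qed

text \<open>Here \<open>p q\<close> is congruent to \<open>- q ^ 2\<close>, hence to
  \<open>-1\<close>, modulo 3, so the criteria apply with \<open>s = -1\<close>.\<close>

lemma minima_if_opposite_residue:
  assumes "[int p = - int q] (mod 3)"
  shows "\<alpha> \<in> lattice_minima \<sigma> OL \<longleftrightarrow> 8 * real q \<le> real p"
    and "\<alpha>' \<in> lattice_minima \<sigma> OL \<longleftrightarrow> Z_plus ^ 3 * real q \<le> real p"
proof -
  obtain l where l: "int q ^ 2 = 1 + 3 * l" using square_mod3_if_not_dvd three_not_dvd by blast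
  have pq: "3 dvd int p + int q" using assms by (simp add: cong_iff_dvd_diff)
  have "int p * int q - (- 1) = (int p + int q) * int q - 3 * l"
    using l by (simp add: algebra_simps power2_eq_square)
  then have s: "3 dvd int p * int q - (- 1)" using pq by simp
  have "8 * real q \<le> real p \<longleftrightarrow> 2 \<le> t" using less_cube_iff[of 2] by (simp flip: not_less)
  then show "\<alpha> \<in> lattice_minima \<sigma> OL \<longleftrightarrow> 8 * real q \<le> real p"
    using alpha_minimum[of "-1"] alpha_not_minimum[of "-1"] s pq by (auto simp: not_le)
  have "0 \<le> Z_plus" using Z_plus_approx by (auto simp: abs_if split: if_splits)
  then have "Z_plus ^ 3 * real q \<le> real p \<longleftrightarrow> Z_plus \<le> t"
    using less_cube_iff[of Z_plus] by (simp flip: not_less)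
  then show "\<alpha>' \<in> lattice_minima \<sigma> OL \<longleftrightarrow> Z_plus ^ 3 * real q \<le> real p"
    using alpha'_minimum[of "-1"] alpha'_not_minimum s pq by (auto simp: not_le)
qed

text \<open>Neither number is divisible by 3, so both residues are \<open>\<plusminus>1\<close>;
  \<open>\<noteq>\<close> between truth values is exclusive or.\<close>

lemma residue_cases: "[int p = int q] (mod 3) \<noteq> [int p = - int q] (mod 3)"
proof -
  obtain a r where "int p = r + 3 * a" "r \<in> {-1, 0, 1}" by (rule int_residue_cases3)
  moreover obtain b s where "int q = s + 3 * b" "s \<in> {-1, 0, 1}" by (rule int_residue_cases3)
  ultimately show ?thesis using three_not_dvd unfolding cong_iff_dvd_diff by auto presburger+
qed

end

theorem theorem7p6:
  fixes d d3 d4 :: nat and \<zeta> :: complex and \<sigma> :: "complex \<Rightarrow> complex"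
    and \<alpha> \<alpha>bar :: real
  assumes "d = d3 * d4 ^ 2"
    and "squarefree d3" and "squarefree d4" and "coprime d3 d4" and "d4 < d3"
    and "[int d = 2] (mod 9) \<or> [int d = - 2] (mod 9) \<or> [int d = 4] (mod 9) \<or> [int d = - 4] (mod 9)"
    and "\<zeta> ^ 3 = 1" and "\<zeta> \<noteq> 1"
    and "is_cubic_conjugation d \<zeta> \<sigma>"
    and "principal_factor d \<zeta> \<sigma> \<alpha>"
    and "cubic_norm \<sigma> \<alpha> = of_nat (9 * d4)"
    and "\<alpha>bar = \<alpha> ^ 2 / 3"
  shows "((\<alpha> \<notin> lattice_minima \<sigma> (maximal_order (pure_cubic_field d)) \<and>
          \<alpha>bar \<notin> lattice_minima \<sigma> (maximal_order (pure_cubic_field d)))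
         \<longleftrightarrow> [int d3 = - int d4] (mod 3) \<and> real d3 < Z_plus ^ 3 * real d4)
       \<and> ((\<alpha> \<notin> lattice_minima \<sigma> (maximal_order (pure_cubic_field d)) \<and>
          \<alpha>bar \<in> lattice_minima \<sigma> (maximal_order (pure_cubic_field d)))
         \<longleftrightarrow> ([int d3 = - int d4] (mod 3) \<and> Z_plus ^ 3 * real d4 \<le> real d3 \<and> real d3 < 8 * real d4) \<or>
             ([int d3 = int d4] (mod 3) \<and> real d3 < C1 ^ 3 * real d4))
       \<and> ((\<alpha> \<in> lattice_minima \<sigma> (maximal_order (pure_cubic_field d)) \<and>
          \<alpha>bar \<in> lattice_minima \<sigma> (maximal_order (pure_cubic_field d)))
         \<longleftrightarrow> ([int d3 = - int d4] (mod 3) \<and> 8 * real d4 \<le> real d3) \<or>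
             ([int d3 = int d4] (mod 3) \<and> C1 ^ 3 * real d4 \<le> real d3))"
proof -
  have "(int d3 * int d4 ^ 2) mod 9 \<in> {2, 4, 5, 7}"
    using assms(6) unfolding assms(1) by (auto simp: cong_def)
  then interpret pure_cubic_factor d3 d4 d \<zeta> \<sigma> \<alpha>
    using assms by unfold_locales auto
  have bar: "\<alpha>bar = \<alpha>'" unfolding assms(12) \<alpha>'_def ..
  show ?thesis
  proof (cases "[int d3 = int d4] (mod 3)")
    case True
    then have "\<not> [int d3 = - int d4] (mod 3)" using residue_cases by simp
    with minima_if_same_residue[OF True] True show ?thesis unfolding bar by auto
  next
    case False
    then have opp: "[int d3 = - int d4] (mod 3)" using residue_cases by simp
    \<comment> \<open>This orders the two thresholds: if the second factor is not a minimum, neither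
      is the first.\<close>
    have "Z_plus ^ 3 < 2 ^ 3"
      using Z_plus_approx by (intro power_strict_mono) (auto simp: abs_if split: if_splits)
    then have "Z_plus ^ 3 * real d4 \<le> 8 * real d4" by (intro mult_right_mono) auto
    with minima_if_opposite_residue[OF opp] opp False show ?thesis unfolding bar by auto
  qed
qed

end
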